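(* Let $\lambda\in\mathbb{R}$. For every $s\ge 0$, every $2<p\le\infty$ and every $\gamma\ge\gamma_p=\frac32+\frac1p$, there exists a real-valued $\xi\in\hat b^{s,p}$ such that the Cauchy problem $$i\partial_t u+\partial_{xx}u+\xi u=\lambda|u|^2u\quad (x\in\mathbb{T},\ t>0),\qquad u(0,x)=u_0(x),$$ is ill-posed in $H^{s+\gamma}(\mathbb{T})$.
   Context: $\mathbb{T}=(-\pi,\pi)$ is the one-dimensional torus (periodic boundary conditions); $u(t,x)$ is complex-valued. Write $f(x)=\sum_{k\in\mathbb{Z}}\hat f_k e^{ikx}$. For $s\ge 0$, $1\le p\le\infty$, $\hat b^{s,p}=\{f:\ |\hat f_0|+\||k|^s\hat f_k\|_{l^p_k}<\infty\}$ (with $\frac1\infty=0$). $H^\sigma(\mathbb{T})$ is the usual $L^2$-based Sobolev space. Solutions are understood through Duhamel's formula $u(t)=e^{it\partial_x^2}u_0+i\int_0^te^{i(t-\rho)\partial_x^2}\big(\xi u(\rho)-\lambda|u(\rho)|^2u(\rho)\big)\,d\rho$, and $u[u_0]$ denotes the solution with data $u_0$. Ill-posedness in $X_0$: for $\epsilon>0$ let $B(\epsilon)=\{u_0\in\mathcal{S}:\ \|u_0\|_{X_0}\le\epsilon\}$, where $\mathcal S$ is the Schwartz space (on $\mathbb{T}$: smooth periodic functions). The problem is ill-posed in $X_0$ if for arbitrarily small $\epsilon>0$ there exists $u_0\in B(\epsilon)$ such that the solution map $u_0\mapsto u[u_0]$ is discontinuous from $X_0$ to $C([0,1];X_0)$.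 *)

theory Defs
  imports "HOL-Analysis.Analysis"
begin

section \<open>Functions and distributions on the torus\<close>

text \<open>Functions on the torus are \<open>2\<pi>\<close>-periodic functions on the real line.  Elements of \<open>L\<^sup>2\<close> and
  \<open>H\<^sup>\<sigma>\<close> are represented by arbitrary measurable representatives; everything below depends on
  them only through their Fourier coefficients, i.e. up to almost everywhere equality.\<close>

definition periodic :: "(real \<Rightarrow> complex) \<Rightarrow> bool" where
  "periodic f \<longleftrightarrow> (\<forall>x. f (x + 2 * pi) = f x)"

definition nth_deriv :: "nat \<Rightarrow> (real \<Rightarrow> complex) \<Rightarrow> real \<Rightarrow> complex" where
  "nth_deriv n = (\<lambda>g x. vector_derivative g (at x)) ^^ n"

definition smooth_periodic :: "(real \<Rightarrow> complex) set" where
  "smooth_periodic = {f. periodic f \<and> (\<forall>n. nth_deriv n f differentiable_on UNIV)}"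

definition fourier_coeff :: "(real \<Rightarrow> complex) \<Rightarrow> int \<Rightarrow> complex" where
  "fourier_coeff f k =
     (LINT x:{-pi..pi}|lebesgue. f x * cis (- (of_int k * x))) / of_real (2 * pi)"

definition L2_periodic :: "(real \<Rightarrow> complex) set" where
  "L2_periodic = {f. periodic f \<and> f \<in> borel_measurable lebesgue \<and>
     set_integrable lebesgue {-pi..pi} (\<lambda>x. (cmod (f x))\<^sup>2)}"

definition sobolev :: "real \<Rightarrow> (real \<Rightarrow> complex) set" where
  "sobolev \<sigma> = {f \<in> L2_periodic.
     (\<lambda>k::int. (1 + (of_int k)\<^sup>2) powr \<sigma> * (cmod (fourier_coeff f k))\<^sup>2) summable_on UNIV}"

definition sobolev_norm :: "real \<Rightarrow> (real \<Rightarrow> complex) \<Rightarrow> real" where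
  "sobolev_norm \<sigma> f =
     sqrt (\<Sum>\<^sub>\<infinity>k::int. (1 + (of_int k)\<^sup>2) powr \<sigma> * (cmod (fourier_coeff f k))\<^sup>2)"

text \<open>A periodic distribution is a continuous linear functional on the smooth periodic functions,
  a function \<open>f\<close> acting as \<open>\<phi> \<mapsto> \<integral> f \<phi>\<close>.  Only its values on test functions are relevant.\<close>

definition periodic_distribution :: "((real \<Rightarrow> complex) \<Rightarrow> complex) \<Rightarrow> bool" where
  "periodic_distribution T \<longleftrightarrow>
     (\<forall>\<phi>\<in>smooth_periodic. \<forall>\<psi>\<in>smooth_periodic. T (\<lambda>x. \<phi> x + \<psi> x) = T \<phi> + T \<psi>) \<and>
     (\<forall>c. \<forall>\<phi>\<in>smooth_periodic. T (\<lambda>x. c * \<phi> x) = c * T \<phi>) \<and>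
     (\<exists>C N. \<forall>\<phi>\<in>smooth_periodic.
        cmod (T \<phi>) \<le> C * (\<Sum>j\<le>N. SUP x\<in>{-pi..pi}. cmod (nth_deriv j \<phi> x)))"

definition real_valued_dist :: "((real \<Rightarrow> complex) \<Rightarrow> complex) \<Rightarrow> bool" where
  "real_valued_dist T \<longleftrightarrow>
     (\<forall>\<phi>\<in>smooth_periodic. (\<forall>x. \<phi> x \<in> \<real>) \<longrightarrow> T \<phi> \<in> \<real>)"

definition dist_coeff :: "((real \<Rightarrow> complex) \<Rightarrow> complex) \<Rightarrow> int \<Rightarrow> complex" where
  "dist_coeff T k = T (\<lambda>x. cis (- (of_int k * x))) / of_real (2 * pi)"

definition in_lp :: "ereal \<Rightarrow> (int \<Rightarrow> complex) \<Rightarrow> bool" where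
  "in_lp p a \<longleftrightarrow> (if p = \<infinity> then bounded (range a)
     else (\<lambda>k. cmod (a k) powr real_of_ereal p) summable_on UNIV)"

text \<open>For \<open>1 \<le> p \<le> \<infinity>\<close>.  The coefficient at \<open>k = 0\<close> is always finite, so the term
  \<open>\<bar>f\<^sub>0\<bar>\<close> of the norm and the value of \<open>0 powr 0\<close> play no role for membership.\<close>

definition b_hat :: "real \<Rightarrow> ereal \<Rightarrow> ((real \<Rightarrow> complex) \<Rightarrow> complex) set" where
  "b_hat s p = {T. periodic_distribution T \<and>
     in_lp p (\<lambda>k. of_real (\<bar>of_int k\<bar> powr s) * dist_coeff T k)}"

section \<open>Duhamel solutions and ill-posedness\<close>

text \<open>Fourier coefficients of the product of a distribution and a function.  The series converges
  absolutely when \<open>\<xi>\<close> has bounded coefficients and \<open>v \<in> H\<^sup>\<sigma>\<close> with \<open>\<sigma> > 1/2\<close>, in particular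
  for \<open>\<xi> \<in> b_hat s p\<close> with \<open>s \<ge> 0\<close>.\<close>

definition mult_coeff ::
    "((real \<Rightarrow> complex) \<Rightarrow> complex) \<Rightarrow> (real \<Rightarrow> complex) \<Rightarrow> int \<Rightarrow> complex" where
  "mult_coeff \<xi> v k = (\<Sum>\<^sub>\<infinity>l. dist_coeff \<xi> (k - l) * fourier_coeff v l)"

definition forcing_coeff ::
    "((real \<Rightarrow> complex) \<Rightarrow> complex) \<Rightarrow> real \<Rightarrow> (real \<Rightarrow> complex) \<Rightarrow> int \<Rightarrow> complex" where
  "forcing_coeff \<xi> lam v k =
     mult_coeff \<xi> v k - of_real lam * fourier_coeff (\<lambda>x. of_real ((cmod (v x))\<^sup>2) * v x) k"

text \<open>The group generated by \<open>i \<partial>\<^sub>x\<^sup>2\<close>, acting on Fourier coefficients.\<close>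

definition schrodinger_group :: "real \<Rightarrow> (int \<Rightarrow> complex) \<Rightarrow> int \<Rightarrow> complex" where
  "schrodinger_group t a k = cis (- t * (of_int k)\<^sup>2) * a k"

definition continuous_curve :: "real \<Rightarrow> (real \<Rightarrow> real \<Rightarrow> complex) \<Rightarrow> bool" where
  "continuous_curve \<sigma> u \<longleftrightarrow>
     (\<forall>t\<in>{0..1}. u t \<in> sobolev \<sigma>) \<and>
     (\<forall>t\<in>{0..1}. ((\<lambda>\<tau>. sobolev_norm \<sigma> (\<lambda>x. u \<tau> x - u t x)) \<longlongrightarrow> 0) (at t within {0..1}))"

text \<open>Solutions in \<open>C([0,1]; H\<^sup>\<sigma>)\<close>.  Duhamel's formula is an identity between periodic
  distributions, i.e. between all their Fourier coefficients.\<close>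

definition duhamel_solution ::
    "((real \<Rightarrow> complex) \<Rightarrow> complex) \<Rightarrow> real \<Rightarrow> real \<Rightarrow> (real \<Rightarrow> complex) \<Rightarrow>
     (real \<Rightarrow> real \<Rightarrow> complex) \<Rightarrow> bool" where
  "duhamel_solution \<xi> lam \<sigma> u0 u \<longleftrightarrow> continuous_curve \<sigma> u \<and>
     (\<forall>t\<in>{0..1}. \<forall>k. fourier_coeff (u t) k =
        schrodinger_group t (fourier_coeff u0) k +
        \<i> * integral {0..t} (\<lambda>\<rho>. schrodinger_group (t - \<rho>) (forcing_coeff \<xi> lam (u \<rho>)) k))"

text \<open>The solution map into \<open>C([0,1]; H\<^sup>\<sigma>)\<close> fails to be continuous at \<open>u0\<close>: \<open>u0\<close> has a solution
  \<open>u\<close>, but data arbitrarily close to \<open>u0\<close> have no solution in \<open>C([0,1]; H\<^sup>\<sigma>)\<close> that stays close to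
  \<open>u\<close>.  This includes the case that the solution with such data leaves \<open>H\<^sup>\<sigma>\<close>.  Uniqueness of
  solutions is not presupposed: no choice of solutions gives a map continuous at \<open>u0\<close>.\<close>

definition solution_map_discontinuous_at ::
    "((real \<Rightarrow> complex) \<Rightarrow> complex) \<Rightarrow> real \<Rightarrow> real \<Rightarrow> (real \<Rightarrow> complex) \<Rightarrow> bool" where
  "solution_map_discontinuous_at \<xi> lam \<sigma> u0 \<longleftrightarrow>
     (\<exists>u. duhamel_solution \<xi> lam \<sigma> u0 u) \<and>
     (\<forall>u. duhamel_solution \<xi> lam \<sigma> u0 u \<longrightarrow>
        \<not> (\<forall>e>0. \<exists>d>0. \<forall>v\<in>sobolev \<sigma>. sobolev_norm \<sigma> (\<lambda>x. v x - u0 x) < d \<longrightarrow>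
             (\<exists>w. duhamel_solution \<xi> lam \<sigma> v w \<and>
                  (\<forall>t\<in>{0..1}. sobolev_norm \<sigma> (\<lambda>x. w t x - u t x) < e))))"

definition smooth_ball :: "real \<Rightarrow> real \<Rightarrow> (real \<Rightarrow> complex) set" where
  "smooth_ball \<sigma> \<epsilon> = {u0 \<in> smooth_periodic. sobolev_norm \<sigma> u0 \<le> \<epsilon>}"

definition ill_posed :: "((real \<Rightarrow> complex) \<Rightarrow> complex) \<Rightarrow> real \<Rightarrow> real \<Rightarrow> bool" where
  "ill_posed \<xi> lam \<sigma> \<longleftrightarrow>
     (\<forall>\<epsilon>>0. \<exists>u0\<in>smooth_ball \<sigma> \<epsilon>. solution_map_discontinuous_at \<xi> lam \<sigma> u0)"

end

theory Submission imports Defs begin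

text \<open>
  A potential whose Fourier coefficients decay too slowly destroys the regularity of solutions
  immediately, even for constant data.  Let \<open>u\<close> be a solution in
  \<open>C([0,1]; H\<^sup>\<sigma>)\<close>, and integrate the equation for its \<open>k\<close>-th Fourier coefficient over
  \<open>[0,T]\<close>.  Only boundary terms and averages survive:
  \<open>\<integral> (\<xi> u)\<^sub>k dt = k\<^sup>2 \<integral> u\<^sub>k dt - \<i> (u\<^sub>k(T) - u\<^sub>k(0)) + \<lambda> \<integral> (|u|\<^sup>2 u)\<^sub>k dt\<close>.
  Two derivatives are lost on the right-hand side, so with \<open>V = \<integral> u dt \<in> H\<^sup>\<sigma>\<close> the product \<open>\<xi> V\<close>
  belongs to \<open>H\<^sup>\<sigma>\<^sup>-\<^sup>2\<close>.  No oscillatory analysis enters: the average in time gains the two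
  derivatives exactly as for an elliptic equation.

  For constant data \<open>\<delta> > 0\<close> and short \<open>T\<close>, continuity in time makes \<open>V\<close> close to the constant
  \<open>T \<delta>\<close> in \<open>H\<^sup>\<sigma>\<close>, hence \<open>V / (T \<delta>) = 1 - E\<close> with \<open>E\<close> small in a weighted Wiener algebra that
  acts on \<open>H\<^sup>\<sigma>\<^sup>-\<^sup>2\<close> by convolution of Fourier coefficients; this uses \<open>\<sigma> \<ge> 3/2\<close>.  The Neumann
  series inverts \<open>1 - E\<close> and yields \<open>\<xi> \<in> H\<^sup>\<sigma>\<^sup>-\<^sup>2\<close> (lemma \<open>neumann_regularity\<close>).  Consequently, if
  \<open>\<xi>\<close> has bounded coefficients and is not in \<open>H\<^sup>\<sigma>\<^sup>-\<^sup>2\<close>, then no positive constant is the initial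
  datum of a solution (lemma \<open>no_duhamel_solution_constant_data\<close>).  Constants are arbitrarily close to \<open>0\<close>, and
  \<open>0\<close> has the zero solution, so the solution map is discontinuous at \<open>0\<close>, which lies in every ball.

  What remains is an element of \<open>b_hat s p\<close> outside \<open>H\<^sup>s\<^sup>+\<^sup>\<gamma>\<^sup>-\<^sup>2\<close>.  The coefficients
  \<open>|k|\<^sup>-\<^sup>s\<^sup>-\<^sup>1\<^sup>/\<^sup>p (ln (1 + |k|))\<^sup>-\<^sup>1\<^sup>/\<^sup>2\<close> work at the critical exponent: the \<open>p\<close>-th powers of
  \<open>|k|\<^sup>s \<xi>\<^sub>k\<close> form the convergent Bertrand series \<open>\<Sum> 1/(k (ln k)\<^sup>p\<^sup>/\<^sup>2)\<close> since \<open>p > 2\<close>, while the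
  \<open>H\<^sup>s\<^sup>-\<^sup>1\<^sup>/\<^sup>2\<^sup>+\<^sup>1\<^sup>/\<^sup>p\<close> norm squared is the divergent \<open>\<Sum> 1/(k ln k)\<close>.
\<close>

section \<open>Weighted sequence spaces\<close>

definition wgt :: "real \<Rightarrow> int \<Rightarrow> real" where
  "wgt m k = (1 + \<bar>of_int k\<bar>) powr m"

text \<open>A weighted \<open>l\<^sup>2\<close> bound, demanded of all finite partial sums.  In this form finite Minkowski
  inequalities apply directly and bounds pass to pointwise limits, without any convergence question.
  For \<open>m = \<sigma>\<close> it characterises the Fourier coefficients of \<open>H\<^sup>\<sigma>\<close>, also for negative \<open>\<sigma>\<close>.\<close>

definition weighted_l2 :: "real \<Rightarrow> (int \<Rightarrow> complex) \<Rightarrow> real \<Rightarrow> bool" where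
  "weighted_l2 m a B \<longleftrightarrow> (\<forall>K. finite K \<longrightarrow> L2_set (\<lambda>k. wgt m k * cmod (a k)) K \<le> B)"

definition weighted_l1 :: "real \<Rightarrow> (int \<Rightarrow> complex) \<Rightarrow> real \<Rightarrow> bool" where
  "weighted_l1 m a B \<longleftrightarrow> (\<forall>K. finite K \<longrightarrow> (\<Sum>k\<in>K. wgt m k * cmod (a k)) \<le> B)"

lemma wgt_pos [simp]: "0 < wgt m k"
  by (auto simp: wgt_def)

lemma wgt_nonneg [simp]: "0 \<le> wgt m k"
  by (rule less_imp_le) simp

lemma wgt_0 [simp]: "wgt 0 k = 1"
  by (auto simp: wgt_def)

lemma wgt_uminus [simp]: "wgt m (- k) = wgt m k"
  by (simp add: wgt_def)

lemma wgt_ge_1: "0 \<le> m \<Longrightarrow> 1 \<le> wgt m k"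
  by (simp add: wgt_def ge_one_powr_ge_zero)

lemma wgt_mono: "m \<le> n \<Longrightarrow> wgt m k \<le> wgt n k"
  by (simp add: wgt_def powr_mono)

lemma wgt_mult: "wgt m k * wgt n k = wgt (m + n) k"
  by (simp add: wgt_def powr_add)

text \<open>Peetre's inequality, from \<open>1 + |k + l| \<le> (1 + |k|) (1 + |l|)\<close>; for negative exponents the roles of
  \<open>k\<close> and \<open>k + l\<close> are exchanged.  It makes the weighted \<open>l\<^sup>1\<close> sequences act on weighted \<open>l\<^sup>2\<close>.\<close>

lemma wgt_add_le: "wgt m (k + l) \<le> wgt m k * wgt \<bar>m\<bar> l"
proof (cases "m \<ge> 0")
  case True
  have "1 + \<bar>real_of_int (k + l)\<bar> \<le> (1 + \<bar>of_int k\<bar>) * (1 + \<bar>of_int l\<bar>)"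
    using abs_triangle_ineq[of "real_of_int k" "real_of_int l"]
      mult_nonneg_nonneg[OF abs_ge_zero[of "real_of_int k"] abs_ge_zero[of "real_of_int l"]]
    unfolding distrib_left distrib_right of_int_add by linarith
  then have "wgt m (k + l) \<le> ((1 + \<bar>of_int k\<bar>) * (1 + \<bar>of_int l\<bar>)) powr m"
    unfolding wgt_def using True by (intro powr_mono2) auto
  then show ?thesis
    using True by (simp add: wgt_def powr_mult)
next
  case False
  have "1 + \<bar>real_of_int k\<bar> \<le> (1 + \<bar>of_int (k + l)\<bar>) * (1 + \<bar>of_int l\<bar>)"
    using abs_triangle_ineq4[of "real_of_int (k + l)" "real_of_int l"]
      mult_nonneg_nonneg[OF abs_ge_zero[of "real_of_int (k + l)"] abs_ge_zero[of "real_of_int l"]]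
    unfolding distrib_left distrib_right of_int_add add_diff_cancel_right' by linarith
  then have "(1 + \<bar>real_of_int k\<bar>) powr (- m) \<le> ((1 + \<bar>of_int (k + l)\<bar>) * (1 + \<bar>of_int l\<bar>)) powr (- m)"
    using False by (intro powr_mono2) auto
  then have "wgt (- m) k \<le> wgt (- m) (k + l) * wgt (- m) l"
    by (simp add: wgt_def powr_mult)
  then have "wgt m k * wgt m (k + l) * wgt (- m) k \<le> wgt m k * wgt m (k + l) * (wgt (- m) (k + l) * wgt (- m) l)"
    by (intro mult_left_mono) auto
  moreover have "wgt m k * wgt m (k + l) * wgt (- m) k = wgt m (k + l)"
    using wgt_mult[of m k "- m"] by (simp add: wgt_def mult_ac)
  moreover have "wgt m k * wgt m (k + l) * (wgt (- m) (k + l) * wgt (- m) l) = wgt m k * wgt (- m) l"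
    using wgt_mult[of m "k + l" "- m"] by (simp add: wgt_def mult_ac)
  ultimately show ?thesis
    using False by simp
qed

lemma summable_on_int_even:
  fixes f :: "int \<Rightarrow> real"
  assumes "\<And>k. 0 \<le> f k" "\<And>k. f (- k) = f k" "summable (\<lambda>n. f (int n))"
  shows "f summable_on UNIV"
proof -
  have n: "(\<lambda>n. f (int n)) summable_on UNIV"
    using assms by (intro summable_nonneg_imp_summable_on) auto
  have "f summable_on range int"
    using n by (subst summable_on_reindex) (auto simp: o_def)
  moreover have "f summable_on range (\<lambda>n. - int n)"
    using n assms(2) by (subst summable_on_reindex) (auto simp: o_def inj_on_def)
  ultimately have "f summable_on (range int \<union> range (\<lambda>n. - int n))"
    by (rule summable_on_union)
  also have "range int \<union> range (\<lambda>n. - int n) = UNIV"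
  proof -
    have "k \<in> range int \<union> range (\<lambda>n. - int n)" for k
      by (cases k rule: int_cases2) auto
    then show ?thesis by auto
  qed
  finally show ?thesis .
qed

lemma wgt_summable: "r < -1 \<Longrightarrow> wgt r summable_on UNIV"
proof (rule summable_on_int_even)
  assume "r < -1"
  then have "summable (\<lambda>n. real (Suc n) powr r)"
    by (subst summable_Suc_iff) (simp add: summable_real_powr_iff)
  then show "summable (\<lambda>n. wgt r (int n))"
    by (simp add: wgt_def add_ac)
qed auto

lemma weighted_l2D: "weighted_l2 m a B \<Longrightarrow> finite K \<Longrightarrow> L2_set (\<lambda>k. wgt m k * cmod (a k)) K \<le> B"
  by (simp add: weighted_l2_def)

lemma weighted_l2_nonneg: "weighted_l2 m a B \<Longrightarrow> 0 \<le> B"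
  using weighted_l2D[of m a B "{}"] by simp

text \<open>Comparison of weighted norms; the extra weight with exponent \<open>r\<close> accounts for the loss of
  \<open>r\<close> derivatives.\<close>

lemma weighted_l2_subst: 
  assumes "weighted_l2 m a B" "\<And>k. cmod (b k) \<le> wgt r k * cmod (a k)" "n + r \<le> m"
  shows "weighted_l2 n b B"
  unfolding weighted_l2_def
proof safe
  fix K :: "int set" assume "finite K"
  have "wgt n k * cmod (b k) \<le> wgt m k * cmod (a k)" for k
  proof -
    have "wgt n k * cmod (b k) \<le> wgt n k * (wgt r k * cmod (a k))"
      by (intro mult_left_mono assms) auto
    also have "\<dots> = wgt (n + r) k * cmod (a k)"
      by (simp add: wgt_mult[symmetric])
    also have "\<dots> \<le> wgt m k * cmod (a k)"
      by (intro mult_right_mono wgt_mono assms) auto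
    finally show ?thesis .
  qed
  then have "L2_set (\<lambda>k. wgt n k * cmod (b k)) K \<le> L2_set (\<lambda>k. wgt m k * cmod (a k)) K"
    by (intro L2_set_mono) auto
  also have "\<dots> \<le> B"
    using assms(1) \<open>finite K\<close> by (rule weighted_l2D)
  finally show "L2_set (\<lambda>k. wgt n k * cmod (b k)) K \<le> B" .
qed

lemma weighted_l2_mono: "weighted_l2 m a B \<Longrightarrow> n \<le> m \<Longrightarrow> weighted_l2 n a B"
  by (rule weighted_l2_subst[where r = 0]) (auto simp: wgt_def)

lemma weighted_l2_mono_bound: "weighted_l2 m a B \<Longrightarrow> B \<le> C \<Longrightarrow> weighted_l2 m a C"
  by (fastforce simp: weighted_l2_def)

lemma weighted_l2_add:
  assumes "weighted_l2 m a A" "weighted_l2 m b B"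
  shows "weighted_l2 m (\<lambda>k. a k + b k) (A + B)"
  unfolding weighted_l2_def
proof safe
  fix K :: "int set" assume K: "finite K"
  have "L2_set (\<lambda>k. wgt m k * cmod (a k + b k)) K
      \<le> L2_set (\<lambda>k. wgt m k * cmod (a k) + wgt m k * cmod (b k)) K"
    by (intro L2_set_mono) (auto simp flip: distrib_left intro: mult_left_mono norm_triangle_ineq)
  also have "\<dots> \<le> L2_set (\<lambda>k. wgt m k * cmod (a k)) K + L2_set (\<lambda>k. wgt m k * cmod (b k)) K"
    by (rule L2_set_triangle_ineq)
  also have "\<dots> \<le> A + B"
    using assms K by (intro add_mono weighted_l2D)
  finally show "L2_set (\<lambda>k. wgt m k * cmod (a k + b k)) K \<le> A + B" .
qed

lemma weighted_l2_scale:
  assumes "weighted_l2 m a A"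
  shows "weighted_l2 m (\<lambda>k. c * a k) (cmod c * A)"
  unfolding weighted_l2_def
proof safe
  fix K :: "int set" assume K: "finite K"
  have "L2_set (\<lambda>k. wgt m k * cmod (c * a k)) K = cmod c * L2_set (\<lambda>k. wgt m k * cmod (a k)) K"
    by (subst L2_set_right_distrib) (simp_all add: norm_mult mult.left_commute)
  also have "\<dots> \<le> cmod c * A"
    using assms K by (intro mult_left_mono weighted_l2D) auto
  finally show "L2_set (\<lambda>k. wgt m k * cmod (c * a k)) K \<le> cmod c * A" .
qed

text \<open>Fatou's lemma for these norms: each finite partial sum converges.\<close>

lemma weighted_l2_limit:
  assumes "\<And>k. ((\<lambda>n. h n k) \<longlongrightarrow> a k) F" "F \<noteq> bot" "eventually (\<lambda>n. weighted_l2 m (h n) B) F"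
  shows "weighted_l2 m a B"
  unfolding weighted_l2_def
proof safe
  fix K :: "int set" assume K: "finite K"
  have "((\<lambda>n. L2_set (\<lambda>k. wgt m k * cmod (h n k)) K) \<longlongrightarrow> L2_set (\<lambda>k. wgt m k * cmod (a k)) K) F"
    unfolding L2_set_def by (intro tendsto_intros assms)
  then show "L2_set (\<lambda>k. wgt m k * cmod (a k)) K \<le> B"
    using assms(2,3) K by (auto intro!: tendsto_upperbound elim!: eventually_mono dest: weighted_l2D)
qed

lemma weighted_l2_reflect:
  assumes "weighted_l2 m a B"
  shows "weighted_l2 m (\<lambda>k. cnj (a (- k))) B"
  unfolding weighted_l2_def
proof safe
  fix K :: "int set" assume "finite K"
  have "L2_set (\<lambda>k. wgt m k * cmod (cnj (a (- k)))) K = L2_set (\<lambda>k. wgt m k * cmod (a k)) (uminus ` K)"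
    by (simp add: L2_set_def sum.reindex inj_on_def)
  with assms \<open>finite K\<close> show "L2_set (\<lambda>k. wgt m k * cmod (cnj (a (- k)))) K \<le> B"
    by (simp add: weighted_l2D)
qed

lemma weighted_l2_pointwise:
  assumes "weighted_l2 m a B"
  shows "cmod (a k) \<le> wgt (- m) k * B"
proof -
  have "wgt m k * cmod (a k) \<le> B"
    using weighted_l2D[OF assms, of "{k}"] by (simp add: L2_set_def)
  then have "wgt (- m) k * (wgt m k * cmod (a k)) \<le> wgt (- m) k * B"
    by (intro mult_left_mono) auto
  moreover have "wgt (- m) k * wgt m k = 1"
    by (subst wgt_mult) (simp add: wgt_def)
  ultimately show ?thesis
    by (simp flip: mult.assoc)
qed

lemma weighted_l1_summable:
  assumes "weighted_l1 m a A" "0 \<le> m"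
  shows "(\<lambda>k. cmod (a k)) summable_on UNIV"
proof (rule nonneg_bdd_above_summable_on)
  have "(\<Sum>k\<in>K. cmod (a k)) \<le> A" if "finite K" for K
  proof -
    have "(\<Sum>k\<in>K. cmod (a k)) \<le> (\<Sum>k\<in>K. wgt m k * cmod (a k))"
      using wgt_ge_1[OF assms(2)] by (intro sum_mono) (simp add: mult_le_cancel_right1)
    with assms(1) that show ?thesis
      unfolding weighted_l1_def by force
  qed
  then show "bdd_above (sum (\<lambda>k. cmod (a k)) ` {F. F \<subseteq> UNIV \<and> finite F})"
    by (auto intro!: bdd_aboveI)
qed auto

lemma weighted_l1_infsum_le:
  assumes "weighted_l1 m a A" "0 \<le> m"
  shows "(\<Sum>\<^sub>\<infinity>k. cmod (a k)) \<le> A"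
proof (rule infsum_le_finite_sums)
  show "(\<lambda>k. cmod (a k)) summable_on UNIV"
    using assms by (rule weighted_l1_summable)
  show "(\<Sum>k\<in>K. cmod (a k)) \<le> A" if "finite K" for K
  proof -
    have "(\<Sum>k\<in>K. cmod (a k)) \<le> (\<Sum>k\<in>K. wgt m k * cmod (a k))"
      using wgt_ge_1[OF assms(2)] by (intro sum_mono) (simp add: mult_le_cancel_right1)
    with assms(1) that show ?thesis
      unfolding weighted_l1_def by force
  qed
qed

lemma weighted_l1_scale:
  assumes "weighted_l1 m a A"
  shows "weighted_l1 m (\<lambda>k. c * a k) (cmod c * A)"
  unfolding weighted_l1_def
proof safe
  fix K :: "int set" assume K: "finite K"
  have "(\<Sum>k\<in>K. wgt m k * cmod (c * a k)) = cmod c * (\<Sum>k\<in>K. wgt m k * cmod (a k))"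
    by (simp add: norm_mult sum_distrib_left mult.left_commute)
  also have "\<dots> \<le> cmod c * A"
    using assms K by (intro mult_left_mono) (auto simp: weighted_l1_def)
  finally show "(\<Sum>k\<in>K. wgt m k * cmod (c * a k)) \<le> cmod c * A" .
qed

lemma weighted_l1_mono_bound: "weighted_l1 m a A \<Longrightarrow> A \<le> B \<Longrightarrow> weighted_l1 m a B"
  by (fastforce simp: weighted_l1_def)

text \<open>Cauchy's inequality against the square-summable weight with exponent \<open>m - \<sigma> < -1/2\<close>.\<close>

lemma weighted_l1_of_weighted_l2:
  assumes "m + 1 / 2 < \<sigma>"
  shows "\<exists>C\<ge>0. \<forall>a B. weighted_l2 \<sigma> a B \<longrightarrow> weighted_l1 m a (C * B)"
proof -
  define s where "s = (\<Sum>\<^sub>\<infinity>k. wgt (2 * (m - \<sigma>)) k)"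
  have sum: "wgt (2 * (m - \<sigma>)) summable_on UNIV"
    using assms by (intro wgt_summable) (simp add: field_simps)
  have "weighted_l1 m a (sqrt s * B)" if a: "weighted_l2 \<sigma> a B" for a B
    unfolding weighted_l1_def
  proof safe
    fix K :: "int set" assume K: "finite K"
    have "wgt m k = wgt (m - \<sigma>) k * wgt \<sigma> k" for k
      by (simp add: wgt_mult)
    then have "(\<Sum>k\<in>K. wgt m k * cmod (a k)) = (\<Sum>k\<in>K. \<bar>wgt (m - \<sigma>) k\<bar> * \<bar>wgt \<sigma> k * cmod (a k)\<bar>)"
      by (simp add: abs_mult mult.assoc)
    also have "\<dots> \<le> L2_set (wgt (m - \<sigma>)) K * L2_set (\<lambda>k. wgt \<sigma> k * cmod (a k)) K"
      by (rule L2_set_mult_ineq)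
    also have "\<dots> \<le> sqrt s * B"
    proof (intro mult_mono weighted_l2D[OF a K])
      have "(\<Sum>k\<in>K. (wgt (m - \<sigma>) k)\<^sup>2) = (\<Sum>k\<in>K. wgt (2 * (m - \<sigma>)) k)"
        by (intro sum.cong) (simp_all add: power2_eq_square wgt_mult)
      also have "\<dots> \<le> s"
        unfolding s_def using sum K by (intro finite_sum_le_infsum) auto
      finally show "L2_set (wgt (m - \<sigma>)) K \<le> sqrt s"
        by (simp add: L2_set_def)
    qed (auto simp: s_def infsum_nonneg)
    finally show "(\<Sum>k\<in>K. wgt m k * cmod (a k)) \<le> sqrt s * B" .
  qed
  moreover have "0 \<le> sqrt s"
    by (simp add: s_def infsum_nonneg)
  ultimately show ?thesis by blast
qed

section \<open>Convolution and the Neumann series\<close>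

definition conv :: "(int \<Rightarrow> complex) \<Rightarrow> (int \<Rightarrow> complex) \<Rightarrow> int \<Rightarrow> complex" where
  "conv a b k = (\<Sum>\<^sub>\<infinity>l. a (k - l) * b l)"

lemma conv_abs_summable:
  assumes "\<And>k. cmod (a k) \<le> A" "(\<lambda>l. cmod (b l)) summable_on UNIV"
  shows "(\<lambda>l. cmod (a (k - l) * b l)) summable_on UNIV"
proof (rule Infinite_Sum.abs_summable_on_comparison_test')
  show "(\<lambda>l. A * cmod (b l)) summable_on UNIV"
    using assms(2) by (rule summable_on_cmult_right)
  show "cmod (a (k - l) * b l) \<le> A * cmod (b l)" for l
    using assms(1) by (auto simp: norm_mult intro: mult_right_mono)
qed

lemma conv_has_sum:
  assumes "\<And>k. cmod (a k) \<le> A" "(\<lambda>l. cmod (b l)) summable_on UNIV"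
  shows "((\<lambda>l. a (k - l) * b l) has_sum conv a b k) UNIV"
  unfolding conv_def
  by (rule has_sum_infsum, rule Infinite_Sum.abs_summable_summable, rule conv_abs_summable[OF assms])

lemma norm_conv_le:
  assumes "\<And>k. cmod (a k) \<le> A" "(\<lambda>l. cmod (b l)) summable_on UNIV"
  shows "cmod (conv a b k) \<le> A * (\<Sum>\<^sub>\<infinity>l. cmod (b l))"
proof -
  have "cmod (conv a b k) \<le> (\<Sum>\<^sub>\<infinity>l. cmod (a (k - l) * b l))"
    unfolding conv_def using conv_abs_summable[OF assms] by (rule norm_infsum_bound)
  also have "\<dots> \<le> (\<Sum>\<^sub>\<infinity>l. A * cmod (b l))"
    using assms(1) conv_abs_summable[OF assms]
    by (intro infsum_mono summable_on_cmult_right assms(2)) (auto simp: norm_mult intro: mult_right_mono)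
  also have "\<dots> = A * (\<Sum>\<^sub>\<infinity>l. cmod (b l))"
    by (rule infsum_cmult_right')
  finally show ?thesis .
qed

lemma L2_set_sum_le:
  "finite L \<Longrightarrow> L2_set (\<lambda>k. \<Sum>l\<in>L. f l k) K \<le> (\<Sum>l\<in>L. L2_set (f l) K)"
proof (induction L rule: finite_induct)
  case empty
  then show ?case by (simp add: L2_set_def)
next
  case (insert x F)
  have "L2_set (\<lambda>k. \<Sum>l\<in>insert x F. f l k) K = L2_set (\<lambda>k. f x k + (\<Sum>l\<in>F. f l k)) K"
    using insert by simp
  also have "\<dots> \<le> L2_set (f x) K + L2_set (\<lambda>k. \<Sum>l\<in>F. f l k) K"
    by (rule L2_set_triangle_ineq)
  finally show ?case
    using insert by simp
qed

text \<open>Young's inequality \<open>l\<^sup>2 * l\<^sup>1 \<subseteq> l\<^sup>2\<close> with weights.  For finitely many \<open>l\<close> the convolution is a sum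
  of translates of \<open>a\<close> with coefficients \<open>b l\<close>, and Minkowski's inequality applies; the weights
  are distributed by Peetre's inequality.  Boundedness of \<open>a\<close> only serves to make the convolution
  converge, since for \<open>m < 0\<close> the weighted bound does not.\<close>

lemma weighted_l2_conv:
  assumes a: "weighted_l2 m a B" "\<And>k. cmod (a k) \<le> C" and b: "weighted_l1 \<bar>m\<bar> b A"
  shows "weighted_l2 m (conv a b) (B * A)"
proof (rule weighted_l2_limit)
  show "((\<lambda>L. \<Sum>l\<in>L. a (k - l) * b l) \<longlongrightarrow> conv a b k) (finite_subsets_at_top UNIV)" for k
    using conv_has_sum[OF a(2) weighted_l1_summable[OF b]] by (simp add: has_sum_def)
  show "\<forall>\<^sub>F L in finite_subsets_at_top UNIV. weighted_l2 m (\<lambda>k. \<Sum>l\<in>L. a (k - l) * b l) (B * A)"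
  proof (rule eventually_finite_subsets_at_top_weakI)
    fix L :: "int set" assume L: "finite L"
    show "weighted_l2 m (\<lambda>k. \<Sum>l\<in>L. a (k - l) * b l) (B * A)"
      unfolding weighted_l2_def
    proof safe
      fix K :: "int set" assume K: "finite K"
      have shift: "L2_set (\<lambda>k. wgt m (k - l) * cmod (a (k - l))) K \<le> B" for l
      proof -
        have "L2_set (\<lambda>k. wgt m (k - l) * cmod (a (k - l))) K
            = L2_set (\<lambda>k. wgt m k * cmod (a k)) ((\<lambda>k. k - l) ` K)"
          by (simp add: L2_set_def sum.reindex inj_on_def)
        with a(1) K show ?thesis
          by (simp add: weighted_l2D)
      qed
      have "wgt m k * cmod (\<Sum>l\<in>L. a (k - l) * b l)
          \<le> (\<Sum>l\<in>L. (wgt \<bar>m\<bar> l * cmod (b l)) * (wgt m (k - l) * cmod (a (k - l))))" for k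
      proof -
        have "wgt m k * cmod (\<Sum>l\<in>L. a (k - l) * b l) \<le> wgt m k * (\<Sum>l\<in>L. cmod (a (k - l)) * cmod (b l))"
          by (intro mult_left_mono sum_norm_le) (auto simp: norm_mult)
        also have "\<dots> = (\<Sum>l\<in>L. wgt m ((k - l) + l) * (cmod (a (k - l)) * cmod (b l)))"
          by (simp add: sum_distrib_left)
        also have "\<dots> \<le> (\<Sum>l\<in>L. (wgt m (k - l) * wgt \<bar>m\<bar> l) * (cmod (a (k - l)) * cmod (b l)))"
          by (intro sum_mono mult_right_mono wgt_add_le) auto
        finally show ?thesis by (simp add: mult_ac)
      qed
      then have "L2_set (\<lambda>k. wgt m k * cmod (\<Sum>l\<in>L. a (k - l) * b l)) K
          \<le> L2_set (\<lambda>k. \<Sum>l\<in>L. (wgt \<bar>m\<bar> l * cmod (b l)) * (wgt m (k - l) * cmod (a (k - l)))) K"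
        by (intro L2_set_mono) auto
      also have "\<dots> \<le> (\<Sum>l\<in>L. L2_set (\<lambda>k. (wgt \<bar>m\<bar> l * cmod (b l)) * (wgt m (k - l) * cmod (a (k - l)))) K)"
        using L by (rule L2_set_sum_le)
      also have "\<dots> = (\<Sum>l\<in>L. (wgt \<bar>m\<bar> l * cmod (b l)) * L2_set (\<lambda>k. wgt m (k - l) * cmod (a (k - l))) K)"
        by (intro sum.cong refl L2_set_right_distrib[symmetric]) auto
      also have "\<dots> \<le> (\<Sum>l\<in>L. (wgt \<bar>m\<bar> l * cmod (b l)) * B)"
        by (intro sum_mono mult_left_mono shift) auto
      also have "\<dots> = B * (\<Sum>l\<in>L. wgt \<bar>m\<bar> l * cmod (b l))"
        by (simp add: sum_distrib_left mult_ac)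
      also have "\<dots> \<le> B * A"
        using b L weighted_l2_nonneg[OF a(1)] by (intro mult_left_mono) (auto simp: weighted_l1_def)
      finally show "L2_set (\<lambda>k. wgt m k * cmod (\<Sum>l\<in>L. a (k - l) * b l)) K \<le> B * A" .
    qed
  qed
qed (auto)

lemma conv_diff_left:
  assumes "\<And>k. cmod (a k) \<le> A" "\<And>k. cmod (a' k) \<le> A'" "(\<lambda>l. cmod (b l)) summable_on UNIV"
  shows "conv (\<lambda>k. a k - a' k) b k = conv a b k - conv a' b k"
proof -
  have "((\<lambda>l. a (k - l) * b l + - (a' (k - l) * b l)) has_sum conv a b k + - conv a' b k) UNIV"
    using conv_has_sum[OF assms(1,3)] conv_has_sum[OF assms(2,3)]
    by (intro has_sum_add) (auto simp: has_sum_uminus)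
  then have "((\<lambda>l. (a (k - l) - a' (k - l)) * b l) has_sum conv a b k - conv a' b k) UNIV"
    by (simp add: left_diff_distrib)
  then show ?thesis
    unfolding conv_def[of "\<lambda>k. a k - a' k"] by (rule infsumI)
qed

text \<open>The unit of convolution is the sequence of Fourier coefficients of the constant \<open>1\<close>.\<close>

lemma conv_delta_add_right:
  assumes "\<And>k. cmod (a k) \<le> A" "(\<lambda>l. cmod (b l)) summable_on UNIV"
  shows "conv a (\<lambda>l. (if l = 0 then 1 else 0) + c * b l) k = a k + c * conv a b k"
proof -
  have "((\<lambda>l. a (k - l) * (if l = 0 then 1 else 0)) has_sum a k) UNIV"
  proof -
    have "((\<lambda>l. a (k - l) * (if l = 0 then 1 else 0)) has_sum (\<Sum>l\<in>{0}. a (k - l) * (if l = 0 then 1 else 0))) {0}"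
      by (rule has_sum_finite) simp
    then show ?thesis
      by (subst has_sum_cong_neutral[where T = "{0}" and g = "\<lambda>l. a (k - l) * (if l = 0 then 1 else 0)"]) auto
  qed
  moreover have "((\<lambda>l. c * (a (k - l) * b l)) has_sum c * conv a b k) UNIV"
    using assms by (intro has_sum_cmult_right conv_has_sum)
  ultimately have "((\<lambda>l. a (k - l) * (if l = 0 then 1 else 0) + c * (a (k - l) * b l)) has_sum a k + c * conv a b k) UNIV"
    by (rule has_sum_add)
  then have "((\<lambda>l. a (k - l) * ((if l = 0 then 1 else 0) + c * b l)) has_sum a k + c * conv a b k) UNIV"
    by (simp only: distrib_left mult.left_commute)
  then show ?thesis
    unfolding conv_def[of a "\<lambda>l. (if l = 0 then 1 else 0) + c * b l"] by (rule infsumI)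
qed

text \<open>Regularity is transferred from \<open>g\<close> to \<open>x\<close> by two contractions at once.  Iteration of
  \<open>h \<mapsto> g + conv h E\<close> from \<open>0\<close> converges to \<open>x\<close> in \<open>l\<^sup>\<infinity>\<close>, because \<open>x\<close> is the fixed point, while
  every iterate stays in the ball of radius \<open>2 B\<close> of the weighted space.  So \<open>x\<close> need not belong
  to the weighted space in advance.\<close>

lemma neumann_regularity:
  assumes x: "\<And>k. cmod (x k) \<le> X" "\<And>k. x k = g k + conv x E k"
    and E: "weighted_l1 \<bar>m\<bar> E (1 / 2)" and g: "weighted_l2 m g B"
  shows "weighted_l2 m x (2 * B)"
proof -
  define h where "h = rec_nat (\<lambda>_. 0) (\<lambda>_ a k. g k + conv a E k)"
  have h0: "h 0 = (\<lambda>_. 0)" and hS: "h (Suc n) = (\<lambda>k. g k + conv (h n) E k)" for n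
    by (simp_all add: h_def)
  have sE: "(\<lambda>k. cmod (E k)) summable_on UNIV" "(\<Sum>\<^sub>\<infinity>k. cmod (E k)) \<le> 1 / 2"
    using weighted_l1_summable[OF E] weighted_l1_infsum_le[OF E] by auto
  have err: "cmod (x k - h n k) \<le> X / 2 ^ n" for n k
  proof (induction n arbitrary: k)
    case 0
    then show ?case using x(1) by (simp add: h0)
  next
    case (Suc n)
    have hb: "cmod (h n k) \<le> X + X / 2 ^ n" for k
      using Suc[of k] x(1)[of k] norm_triangle_ineq4[of "x k" "x k - h n k"] by simp
    have "x k - h (Suc n) k = conv (\<lambda>k. x k - h n k) E k"
      using x(2)[of k] by (simp add: hS conv_diff_left[OF x(1) hb sE(1)])
    also have "cmod \<dots> \<le> X / 2 ^ n * (\<Sum>\<^sub>\<infinity>k. cmod (E k))"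
      using Suc sE(1) by (rule norm_conv_le)
    also have "\<dots> \<le> X / 2 ^ n * (1 / 2)"
      using sE(2) order_trans[OF norm_ge_zero x(1)] by (intro mult_left_mono) auto
    finally show ?case by simp
  qed
  have hb: "cmod (h n k) \<le> X + X / 2 ^ n" for n k
    using err[of k n] x(1)[of k] norm_triangle_ineq4[of "x k" "x k - h n k"] by simp
  have "weighted_l2 m (h n) (2 * B)" for n
  proof (induction n)
    case 0
    then show ?case
      using weighted_l2_nonneg[OF g] by (simp add: h0 weighted_l2_def L2_set_def)
  next
    case (Suc n)
    have "weighted_l2 m (\<lambda>k. g k + conv (h n) E k) (B + 2 * B * (1 / 2))"
      using Suc hb E g by (intro weighted_l2_add weighted_l2_conv)
    then show ?case by (simp add: hS)
  qed
  moreover have "(\<lambda>n. h n k) \<longlonglongrightarrow> x k" for k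
  proof (rule LIM_zero_cancel, rule Lim_null_comparison)
    show "\<forall>\<^sub>F n in sequentially. norm (h n k - x k) \<le> X / 2 ^ n"
      using err by (simp add: norm_minus_commute)
    have "(\<lambda>n. X * (1 / 2) ^ n) \<longlonglongrightarrow> 0"
      by (intro tendsto_mult_right_zero LIMSEQ_power_zero) auto
    then show "(\<lambda>n. X / 2 ^ n) \<longlonglongrightarrow> 0"
      by (simp add: power_one_over)
  qed
  ultimately show ?thesis
    by (intro weighted_l2_limit[where F = sequentially and h = h]) auto
qed

section \<open>Integration in time\<close>

lemma conv_uniform_limit:
  assumes "\<And>t k. t \<in> S \<Longrightarrow> cmod (a t k) \<le> A" "\<And>t k. t \<in> S \<Longrightarrow> cmod (b t k) \<le> M k"
    and "M summable_on UNIV" "0 \<le> A"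
  shows "uniform_limit S (\<lambda>L t. \<Sum>l\<in>L. a t (k - l) * b t l) (\<lambda>t. conv (a t) (b t) k)
    (finite_subsets_at_top UNIV)"
  unfolding conv_def
proof (rule Weierstrass_m_test_general)
  show "(\<lambda>l. A * M l) summable_on UNIV"
    using assms(3) by (rule summable_on_cmult_right)
  show "cmod (a t (k - l) * b t l) \<le> A * M l" if "t \<in> S" for l t
    unfolding norm_mult using assms(1,2)[OF that] assms(4) by (intro mult_mono) auto
qed

lemma conv_continuous_on:
  assumes "\<And>t k. t \<in> S \<Longrightarrow> cmod (a t k) \<le> A" "\<And>t k. t \<in> S \<Longrightarrow> cmod (b t k) \<le> M k"
    and "M summable_on UNIV" "0 \<le> A"
    and "\<And>k. continuous_on S (\<lambda>t. a t k)" "\<And>k. continuous_on S (\<lambda>t. b t k)"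
  shows "continuous_on S (\<lambda>t. conv (a t) (b t) k)"
  by (rule uniform_limit_theorem[OF _ conv_uniform_limit[OF assms(1-4)]])
     (auto intro!: always_eventually continuous_intros assms)

lemma integral_cmod_le:
  fixes f :: "real \<Rightarrow> complex"
  assumes "continuous_on {0..T} f" "\<And>t. t \<in> {0..T} \<Longrightarrow> cmod (f t) \<le> B" "0 \<le> T"
  shows "cmod (integral {0..T} f) \<le> T * B"
  using integral_bound[OF assms(3,1), of B] assms(2) by (simp add: mult.commute)

text \<open>The domination by a summable sequence that is independent of \<open>t\<close> gives uniform convergence
  of the series, so it may be integrated term by term.\<close>

lemma conv_integral:
  fixes T :: real
  assumes "\<And>k. cmod (a k) \<le> A" "\<And>t k. t \<in> {0..T} \<Longrightarrow> cmod (b t k) \<le> M k"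
    and "M summable_on UNIV" "\<And>k. continuous_on {0..T} (\<lambda>t. b t k)" "0 \<le> T"
  shows "integral {0..T} (\<lambda>t. conv a (b t) k) = conv a (\<lambda>l. integral {0..T} (\<lambda>t. b t l)) k"
proof -
  have "0 \<le> A"
    using order_trans[OF norm_ge_zero assms(1)] .
  have ul: "uniform_limit {0..T} (\<lambda>L t. \<Sum>l\<in>L. a (k - l) * b t l) (\<lambda>t. conv a (b t) k)
    (finite_subsets_at_top UNIV)"
    using assms \<open>0 \<le> A\<close> by (intro conv_uniform_limit[where a = "\<lambda>_. a" and A = A]) auto
  obtain I J where IJ: "\<And>L. ((\<lambda>t. \<Sum>l\<in>L. a (k - l) * b t l) has_integral I L) {0..T}"
    "((\<lambda>t. conv a (b t) k) has_integral J) {0..T}" "(I \<longlongrightarrow> J) (finite_subsets_at_top UNIV)"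
  proof (rule uniform_limit_integral[OF ul])
    show "continuous_on {0..T} (\<lambda>t. \<Sum>l\<in>L. a (k - l) * b t l)" for L
      by (intro continuous_intros assms)
  qed auto
  have sb: "(\<lambda>l. cmod (integral {0..T} (\<lambda>t. b t l))) summable_on UNIV"
  proof (rule summable_on_comparison_test)
    show "(\<lambda>l. T * M l) summable_on UNIV"
      using assms(3) by (rule summable_on_cmult_right)
    show "cmod (integral {0..T} (\<lambda>t. b t l)) \<le> T * M l" for l
      using assms by (intro integral_cmod_le) auto
  qed auto
  have "I L = (\<Sum>l\<in>L. a (k - l) * integral {0..T} (\<lambda>t. b t l))" if "finite L" for L
  proof (rule has_integral_unique[OF IJ(1)])
    show "((\<lambda>t. \<Sum>l\<in>L. a (k - l) * b t l) has_integral (\<Sum>l\<in>L. a (k - l) * integral {0..T} (\<lambda>t. b t l))) {0..T}"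
      using assms(4) that
      by (intro has_integral_sum has_integral_mult_right integrable_integral integrable_continuous_real) auto
  qed
  then have "\<forall>\<^sub>F L in finite_subsets_at_top UNIV. I L = (\<Sum>l\<in>L. a (k - l) * integral {0..T} (\<lambda>t. b t l))"
    by (auto intro: eventually_finite_subsets_at_top_weakI)
  then have "(I \<longlongrightarrow> conv a (\<lambda>l. integral {0..T} (\<lambda>t. b t l)) k) (finite_subsets_at_top UNIV)"
    using conv_has_sum[of a A, OF assms(1) sb, of k] unfolding has_sum_def
    by (subst tendsto_cong)
  with IJ(3) have "J = conv a (\<lambda>l. integral {0..T} (\<lambda>t. b t l)) k"
    by (intro tendsto_unique[of "finite_subsets_at_top UNIV"]) auto
  with IJ(2) show ?thesis
    by (simp add: integral_unique)
qed

text \<open>Minkowski's integral inequality, proved by duality: the squared norm of the integral is the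
  integral of the scalar products with the integral itself, to which Cauchy's inequality applies.\<close>

lemma weighted_l2_integral:
  assumes cont: "\<And>k. continuous_on {0..T} (\<lambda>t. f t k)"
    and f: "\<And>t. t \<in> {0..T} \<Longrightarrow> weighted_l2 m (f t) B" and "0 \<le> T"
  shows "weighted_l2 m (\<lambda>k. integral {0..T} (\<lambda>t. f t k)) (T * B)"
  unfolding weighted_l2_def
proof safe
  fix K :: "int set" assume K: "finite K"
  define G where "G k = integral {0..T} (\<lambda>t. f t k)" for k
  define A where "A = L2_set (\<lambda>k. wgt m k * cmod (G k)) K"
  \<comment> \<open>The dual vector: pairing \<open>G\<close> with \<open>c\<close> gives the squared norm of \<open>G\<close>.\<close>
  define c where "c k = of_real (wgt m k) * cnj (G k) * of_real (wgt m k)" for k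
  have "A\<^sup>2 = (\<Sum>k\<in>K. (wgt m k * cmod (G k))\<^sup>2)"
    by (simp add: A_def L2_set_def sum_nonneg)
  also have "of_real \<dots> = (\<Sum>k\<in>K. c k * G k)"
    unfolding of_real_sum
  proof (intro sum.cong refl)
    fix k
    have "of_real ((wgt m k * cmod (G k))\<^sup>2) = of_real ((wgt m k)\<^sup>2) * (G k * cnj (G k))"
      by (simp add: power_mult_distrib flip: complex_norm_square)
    then show "of_real ((wgt m k * cmod (G k))\<^sup>2) = c k * G k"
      by (simp add: c_def power2_eq_square mult_ac)
  qed
  also have "\<dots> = integral {0..T} (\<lambda>t. \<Sum>k\<in>K. c k * f t k)"
    unfolding G_def using cont K
    by (intro integral_unique[symmetric] has_integral_sum has_integral_mult_right integrable_integral
        integrable_continuous_real)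
  finally have "A\<^sup>2 = cmod (integral {0..T} (\<lambda>t. \<Sum>k\<in>K. c k * f t k))"
    by (metis norm_of_real abs_of_nonneg zero_le_power2)
  also have "\<dots> \<le> T * (A * B)"
  proof (rule integral_cmod_le)
    show "continuous_on {0..T} (\<lambda>t. \<Sum>k\<in>K. c k * f t k)"
      by (intro continuous_intros cont)
    fix t assume t: "t \<in> {0..T}"
    have "cmod (\<Sum>k\<in>K. c k * f t k) \<le> (\<Sum>k\<in>K. \<bar>wgt m k * cmod (G k)\<bar> * \<bar>wgt m k * cmod (f t k)\<bar>)"
      by (intro sum_norm_le) (simp add: c_def norm_mult abs_mult)
    also have "\<dots> \<le> A * L2_set (\<lambda>k. wgt m k * cmod (f t k)) K"
      unfolding A_def by (rule L2_set_mult_ineq)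
    also have "\<dots> \<le> A * B"
      using weighted_l2D[OF f[OF t] K] by (intro mult_left_mono) (auto simp: A_def)
    finally show "cmod (\<Sum>k\<in>K. c k * f t k) \<le> A * B" .
  qed (fact assms)
  finally have "A * A \<le> A * (T * B)"
    by (simp add: power2_eq_square mult_ac)
  moreover have "0 \<le> A" "0 \<le> T * B"
    using weighted_l2_nonneg[OF f[of 0]] \<open>0 \<le> T\<close> by (auto simp: A_def)
  ultimately have "A \<le> T * B"
    by (cases "A = 0") auto
  then show "L2_set (\<lambda>k. wgt m k * cmod (integral {0..T} (\<lambda>t. f t k))) K \<le> T * B"
    by (simp add: A_def G_def)
qed

lemma weighted_l1_integral:
  assumes cont: "\<And>k. continuous_on {0..T} (\<lambda>t. f t k)"
    and f: "\<And>t. t \<in> {0..T} \<Longrightarrow> weighted_l1 m (f t) A" and "0 \<le> T"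
  shows "weighted_l1 m (\<lambda>k. integral {0..T} (\<lambda>t. f t k)) (T * A)"
  unfolding weighted_l1_def
proof safe
  fix K :: "int set" assume K: "finite K"
  have int: "(\<lambda>t. wgt m k * cmod (f t k)) integrable_on {0..T}" for k
    by (intro integrable_continuous_real continuous_intros cont)
  have "(\<Sum>k\<in>K. wgt m k * cmod (integral {0..T} (\<lambda>t. f t k)))
      \<le> (\<Sum>k\<in>K. integral {0..T} (\<lambda>t. wgt m k * cmod (f t k)))"
  proof (intro sum_mono)
    fix k
    have "cmod (integral {0..T} (\<lambda>t. f t k)) \<le> integral {0..T} (\<lambda>t. cmod (f t k))"
      by (intro integral_norm_bound_integral integrable_continuous_real continuous_intros cont) auto
    then have "wgt m k * cmod (integral {0..T} (\<lambda>t. f t k)) \<le> wgt m k * integral {0..T} (\<lambda>t. cmod (f t k))"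
      by (intro mult_left_mono) auto
    then show "wgt m k * cmod (integral {0..T} (\<lambda>t. f t k)) \<le> integral {0..T} (\<lambda>t. wgt m k * cmod (f t k))"
      by simp
  qed
  also have "\<dots> = integral {0..T} (\<lambda>t. \<Sum>k\<in>K. wgt m k * cmod (f t k))"
    using K int by (intro integral_sum[symmetric])
  also have "\<dots> \<le> norm (integral {0..T} (\<lambda>t. \<Sum>k\<in>K. wgt m k * cmod (f t k)))"
    by simp
  also have "\<dots> \<le> A * (T - 0)"
  proof (rule integral_bound)
    show "continuous_on {0..T} (\<lambda>t. \<Sum>k\<in>K. wgt m k * cmod (f t k))"
      by (intro continuous_intros cont)
    show "norm (\<Sum>k\<in>K. wgt m k * cmod (f t k)) \<le> A" if "t \<in> {0..T}" for t
      using f[OF that] K by (simp add: sum_nonneg weighted_l1_def)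
  qed fact
  finally show "(\<Sum>k\<in>K. wgt m k * cmod (integral {0..T} (\<lambda>t. f t k))) \<le> T * A"
    by (simp add: mult.commute)
qed

text \<open>Duhamel's formula says that \<open>y' = - \<i> \<kappa> y + \<i> F\<close>; integrate this equation over \<open>[0,T]\<close>.  With
  \<open>\<kappa> = k\<^sup>2\<close> this identity expresses the time average of the forcing through
  quantities controlled in \<open>H\<^sup>\<sigma>\<close>, at the cost of two derivatives.\<close>

lemma duhamel_time_average:
  fixes F y :: "real \<Rightarrow> complex"
  assumes F: "continuous_on {0..T} F" and "0 \<le> T"
    and y: "\<And>t. t \<in> {0..T} \<Longrightarrow>
      y t = cis (- t * \<kappa>) * y0 + \<i> * integral {0..t} (\<lambda>\<rho>. cis (- (t - \<rho>) * \<kappa>) * F \<rho>)"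
  shows "integral {0..T} F = of_real \<kappa> * integral {0..T} y - \<i> * (y T - y 0)"
proof -
  define H where "H t = integral {0..t} (\<lambda>\<rho>. cis (\<rho> * \<kappa>) * F \<rho>)" for t
  define z where "z t = cis (- t * \<kappa>) * (y0 + \<i> * H t)" for t
  have yz: "y t = z t" if "t \<in> {0..T}" for t
  proof -
    have "integral {0..t} (\<lambda>\<rho>. cis (- (t - \<rho>) * \<kappa>) * F \<rho>)
        = integral {0..t} (\<lambda>\<rho>. cis (- t * \<kappa>) * (cis (\<rho> * \<kappa>) * F \<rho>))"
      by (intro integral_cong) (simp add: cis_mult algebra_simps)
    also have "\<dots> = cis (- t * \<kappa>) * H t"
      unfolding H_def by (rule integral_mult_right)
    finally show ?thesis
      using y[OF that] by (simp add: z_def algebra_simps)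
  qed
  have dH: "(H has_vector_derivative cis (t * \<kappa>) * F t) (at t within {0..T})" if "t \<in> {0..T}" for t
    unfolding H_def using that
    by (intro integral_has_vector_derivative continuous_intros F)
  have dc: "((\<lambda>t. cis (- t * \<kappa>)) has_vector_derivative - (\<i> * of_real \<kappa>) * cis (- t * \<kappa>)) (at t within {0..T})" for t
    using exp_scaleR_has_vector_derivative_right[of "- (\<i> * of_real \<kappa>)" t "{0..T}"]
    by (simp add: cis_conv_exp scaleR_conv_of_real mult_ac)
  have dz: "(z has_vector_derivative - (\<i> * of_real \<kappa>) * z t + \<i> * F t) (at t within {0..T})"
    if "t \<in> {0..T}" for t
  proof -
    have "(z has_vector_derivative
        cis (- t * \<kappa>) * (0 + \<i> * (cis (t * \<kappa>) * F t)) + (- (\<i> * of_real \<kappa>) * cis (- t * \<kappa>)) * (y0 + \<i> * H t))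
        (at t within {0..T})"
      unfolding z_def[abs_def]
      by (intro has_vector_derivative_mult has_vector_derivative_add has_vector_derivative_const
        has_vector_derivative_mult_right dc dH that)
    also have "cis (- t * \<kappa>) * (0 + \<i> * (cis (t * \<kappa>) * F t)) + (- (\<i> * of_real \<kappa>) * cis (- t * \<kappa>)) * (y0 + \<i> * H t)
        = - (\<i> * of_real \<kappa>) * z t + \<i> * F t"
    proof -
      have "cis (- t * \<kappa>) * (0 + \<i> * (cis (t * \<kappa>) * F t)) = (cis (- t * \<kappa>) * cis (t * \<kappa>)) * (\<i> * F t)"
        by (simp add: mult_ac)
      also have "\<dots> = \<i> * F t"
        by (simp add: cis_mult)
      finally show ?thesis
        by (simp add: z_def mult.assoc)
    qed
    finally show ?thesis .
  qed
  have "continuous_on {0..T} z"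
    using dz by (intro continuous_on_vector_derivative)
  then have zi: "z integrable_on {0..T}" and Fi: "F integrable_on {0..T}"
    using F by (auto intro: integrable_continuous_real)
  have "((\<lambda>t. - (\<i> * of_real \<kappa>) * z t + \<i> * F t) has_integral z T - z 0) {0..T}"
    using \<open>0 \<le> T\<close> dz by (intro fundamental_theorem_of_calculus) auto
  moreover have "((\<lambda>t. - (\<i> * of_real \<kappa>) * z t + \<i> * F t) has_integral
      - (\<i> * of_real \<kappa>) * integral {0..T} z + \<i> * integral {0..T} F) {0..T}"
    using zi Fi by (intro has_integral_add has_integral_mult_right integrable_integral)
  ultimately have "z T - z 0 = - (\<i> * of_real \<kappa>) * integral {0..T} z + \<i> * integral {0..T} F"
    by (rule has_integral_unique)
  moreover have "integral {0..T} y = integral {0..T} z"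
    using yz by (intro integral_cong)
  moreover have "y T = z T" "y 0 = z 0"
    using yz \<open>0 \<le> T\<close> by auto
  ultimately have "\<i> * integral {0..T} F = \<i> * (of_real \<kappa> * integral {0..T} y - \<i> * (y T - y 0))"
    by (simp add: algebra_simps)
  then show ?thesis
    by simp
qed

section \<open>Fourier coefficients and absolutely convergent Fourier series\<close>

abbreviation torus :: "real measure" where
  "torus \<equiv> lebesgue_on {-pi..pi}"

lemma space_torus [simp]: "space torus = {-pi..pi}"
  by (simp add: space_restrict_space)

lemma finite_measure_torus: "finite_measure torus"
  by (rule finite_measureI) (simp add: emeasure_restrict_space)

lemma borel_measurable_torus: "f \<in> borel_measurable lebesgue \<Longrightarrow> f \<in> borel_measurable torus"
  by (rule measurable_restrict_space1)

lemma continuous_measurable_torus: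
  fixes f :: "real \<Rightarrow> 'a::real_normed_vector"
  assumes "continuous_on UNIV f"
  shows "f \<in> borel_measurable torus"
  using assms by (intro borel_measurable_torus measurable_completion) (auto intro: borel_measurable_continuous_onI)

lemma integrable_torus_iff:
  fixes f :: "real \<Rightarrow> 'a::{banach, second_countable_topology}"
  shows "integrable torus f \<longleftrightarrow> set_integrable lebesgue {-pi..pi} f"
  by (simp add: integrable_restrict_space set_integrable_def)

lemma fourier_coeff_torus:
  "fourier_coeff f k = (LINT x|torus. f x * cis (- (of_int k * x))) / of_real (2 * pi)"
  by (simp add: fourier_coeff_def set_lebesgue_integral_def integral_restrict_space)

lemma integrable_torus_mult_bounded:
  fixes f g :: "real \<Rightarrow> complex"
  assumes "integrable torus f" "g \<in> borel_measurable torus" "\<And>x. cmod (g x) \<le> B"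
  shows "integrable torus (\<lambda>x. f x * g x)"
proof (rule Bochner_Integration.integrable_bound)
  show "integrable torus (\<lambda>x. B * cmod (f x))"
    using assms(1) by (intro integrable_mult_right integrable_norm)
  show "(\<lambda>x. f x * g x) \<in> borel_measurable torus"
    using assms(1,2) by measurable
  have "0 \<le> B"
    using order_trans[OF norm_ge_zero assms(3)] .
  then show "AE x in torus. norm (f x * g x) \<le> norm (B * cmod (f x))"
    using mult_right_mono[OF assms(3) norm_ge_zero[of "f _"]]
    by (intro AE_I2) (simp add: norm_mult abs_mult mult.commute[of "cmod (f _)"])
qed

lemma cis_mult_measurable_torus [measurable]: "(\<lambda>x. cis (c * x)) \<in> borel_measurable torus"
  by (intro continuous_measurable_torus continuous_intros)

lemma integrable_torus_mult_cis:
  "integrable torus f \<Longrightarrow> integrable torus (\<lambda>x. f x * cis (c * x))"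
  by (rule integrable_torus_mult_bounded[where B = 1]) auto

lemma integrable_torus_fourier:
  "integrable torus f \<Longrightarrow> integrable torus (\<lambda>x. f x * cis (- (of_int k * x)))"
  using integrable_torus_mult_cis[of f "- of_int k"] by simp

lemma fourier_coeff_add:
  assumes "integrable torus f" "integrable torus g"
  shows "fourier_coeff (\<lambda>x. f x + g x) k = fourier_coeff f k + fourier_coeff g k"
  using integrable_torus_fourier[OF assms(1)] integrable_torus_fourier[OF assms(2)]
  by (simp add: fourier_coeff_torus distrib_right add_divide_distrib)

lemma fourier_coeff_diff:
  assumes "integrable torus f" "integrable torus g"
  shows "fourier_coeff (\<lambda>x. f x - g x) k = fourier_coeff f k - fourier_coeff g k"
  using integrable_torus_fourier[OF assms(1)] integrable_torus_fourier[OF assms(2)]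
  by (simp add: fourier_coeff_torus left_diff_distrib diff_divide_distrib)

lemma fourier_coeff_cmult: "fourier_coeff (\<lambda>x. c * f x) k = c * fourier_coeff f k"
  by (simp add: fourier_coeff_torus mult.assoc)

lemma fourier_coeff_mult_cis:
  "fourier_coeff (\<lambda>x. f x * cis (of_int l * x)) k = fourier_coeff f (k - l)"
  by (simp add: fourier_coeff_torus mult.assoc cis_mult algebra_simps)

lemma fourier_coeff_cong_AE:
  assumes "AE x in torus. f x = g x" "f \<in> borel_measurable torus" "g \<in> borel_measurable torus"
  shows "fourier_coeff f k = fourier_coeff g k"
proof -
  have [measurable]: "(\<lambda>x. cis (- (of_int k * x))) \<in> borel_measurable torus"
    using cis_mult_measurable_torus[of "- of_int k"] by simp
  have "(LINT x|torus. f x * cis (- (of_int k * x))) = (LINT x|torus. g x * cis (- (of_int k * x)))"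
    using assms by (intro integral_cong_AE) auto
  then show ?thesis
    by (simp add: fourier_coeff_torus)
qed

lemma fourier_coeff_cnj: "fourier_coeff (\<lambda>x. cnj (f x)) k = cnj (fourier_coeff f (- k))"
proof -
  have "(LINT x|torus. cnj (f x) * cis (- (of_int k * x)))
      = (LINT x|torus. cnj (f x * cis (- (of_int (- k) * x))))"
    by (simp add: cis_cnj)
  also have "\<dots> = cnj (LINT x|torus. f x * cis (- (of_int (- k) * x)))"
    by (rule Bochner_Integration.integral_cnj)
  finally show ?thesis
    by (simp add: fourier_coeff_torus)
qed

lemma fourier_coeff_const: "fourier_coeff (\<lambda>x. c) k = (if k = 0 then c else 0)"
proof (cases "k = 0")
  case True
  then show ?thesis
    by (simp add: fourier_coeff_def set_lebesgue_integral_def scaleR_conv_of_real)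
next
  case False
  let ?e = "\<lambda>x. cis (- (of_int k * x))"
  have "integrable torus ?e"
    using integrable_torus_fourier[of "\<lambda>_. 1" k] finite_measure.integrable_const[OF finite_measure_torus] by simp
  then have "(LINT x:{-pi..pi}|lebesgue. ?e x) = integral {-pi..pi} ?e"
    by (intro set_lebesgue_integral_eq_integral) (simp add: integrable_torus_iff)
  also have "\<dots> = ?e pi / (- \<i> * of_int k) - ?e (-pi) / (- \<i> * of_int k)"
  proof (intro integral_unique fundamental_theorem_of_calculus)
    fix x
    have "((\<lambda>x. exp (x *\<^sub>R (- \<i> * of_int k)) * (1 / (- \<i> * of_int k))) has_vector_derivative
       exp (x *\<^sub>R (- \<i> * of_int k)) * (- \<i> * of_int k) * (1 / (- \<i> * of_int k))) (at x within {-pi..pi})"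
      by (intro has_vector_derivative_mult_left exp_scaleR_has_vector_derivative_right)
    with False show "((\<lambda>x. ?e x / (- \<i> * of_int k)) has_vector_derivative ?e x) (at x within {-pi..pi})"
      by (simp add: cis_conv_exp scaleR_conv_of_real mult_ac)
  qed simp
  also have "?e (-pi) = ?e pi"
    by (simp add: complex_eq_iff sin_int_times_real mult.commute[of _ pi])
  finally have "(LINT x:{-pi..pi}|lebesgue. ?e x) = 0"
    by simp
  then have "(LINT x:{-pi..pi}|lebesgue. c * ?e x) = 0"
    by (subst set_integral_mult_right) simp
  with False show ?thesis
    by (simp add: fourier_coeff_def)
qed

definition trig_series :: "(int \<Rightarrow> complex) \<Rightarrow> real \<Rightarrow> complex" where
  "trig_series a x = (\<Sum>\<^sub>\<infinity>k. a k * cis (of_int k * x))"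

lemma trig_series_uniform_limit:
  assumes "(\<lambda>k. cmod (a k)) summable_on UNIV"
  shows "uniform_limit UNIV (\<lambda>L x. \<Sum>k\<in>L. a k * cis (of_int k * x)) (trig_series a) (finite_subsets_at_top UNIV)"
  unfolding trig_series_def[abs_def]
  using assms by (intro Weierstrass_m_test_general[where M = "\<lambda>k. cmod (a k)"]) (auto simp: norm_mult)

lemma continuous_trig_series:
  assumes "(\<lambda>k. cmod (a k)) summable_on UNIV"
  shows "continuous_on UNIV (trig_series a)"
  by (rule uniform_limit_theorem[OF _ trig_series_uniform_limit[OF assms]])
     (auto intro!: always_eventually continuous_intros)

lemma norm_trig_series_le:
  assumes "(\<lambda>k. cmod (a k)) summable_on UNIV"
  shows "cmod (trig_series a x) \<le> (\<Sum>\<^sub>\<infinity>k. cmod (a k))"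
proof -
  have "cmod (trig_series a x) \<le> (\<Sum>\<^sub>\<infinity>k. cmod (a k * cis (of_int k * x)))"
    unfolding trig_series_def using assms by (intro norm_infsum_bound) (simp add: norm_mult)
  then show ?thesis
    by (simp add: norm_mult)
qed

lemma norm_fourier_coeff_le:
  assumes "integrable torus f"
  shows "cmod (fourier_coeff f k) \<le> (LINT x|torus. cmod (f x))"
proof -
  have "cmod (LINT x|torus. f x * cis (- (of_int k * x))) \<le> (LINT x|torus. cmod (f x * cis (- (of_int k * x))))"
    by (rule integral_norm_bound)
  also have "\<dots> = (LINT x|torus. cmod (f x))"
    by (simp add: norm_mult)
  finally have "cmod (fourier_coeff f k) \<le> (LINT x|torus. cmod (f x)) / (2 * pi)"
    by (simp add: fourier_coeff_torus norm_divide divide_right_mono)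
  also have "\<dots> \<le> (LINT x|torus. cmod (f x)) / 1"
    using pi_gt3 by (intro divide_left_mono Bochner_Integration.integral_nonneg) auto
  finally show ?thesis by simp
qed

lemma fourier_coeff_sum:
  assumes "finite L" "\<And>l. l \<in> L \<Longrightarrow> integrable torus (f l)"
  shows "fourier_coeff (\<lambda>x. \<Sum>l\<in>L. f l x) k = (\<Sum>l\<in>L. fourier_coeff (f l) k)"
  using assms
proof (induction L rule: finite_induct)
  case empty
  then show ?case by (simp add: fourier_coeff_const)
next
  case (insert l L)
  then show ?case
    using fourier_coeff_add[of "f l" "\<lambda>x. \<Sum>l\<in>L. f l x" k] by auto
qed

text \<open>The series converges uniformly, hence its product with an integrable function may be integrated
  term by term, and multiplication by \<open>e\<^sup>i\<^sup>l\<^sup>x\<close> shifts the coefficients by \<open>l\<close>.\<close>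

lemma fourier_coeff_mult_trig_series:
  assumes f: "integrable torus f" and a: "(\<lambda>k. cmod (a k)) summable_on UNIV"
  shows "fourier_coeff (\<lambda>x. f x * trig_series a x) k = conv (fourier_coeff f) a k"
proof -
  define S where "S L x = (\<Sum>l\<in>L. a l * cis (of_int l * x))" for L x
  define I where "I = (LINT x|torus. cmod (f x))"
  have I: "0 \<le> I"
    unfolding I_def by (rule Bochner_Integration.integral_nonneg) auto
  have int1: "integrable torus (\<lambda>x. f x * trig_series a x)"
    using f a norm_trig_series_le[OF a]
    by (intro integrable_torus_mult_bounded continuous_measurable_torus continuous_trig_series)
  have partial: "fourier_coeff (\<lambda>x. f x * S L x) k = (\<Sum>l\<in>L. fourier_coeff f (k - l) * a l)"
    and int2: "integrable torus (\<lambda>x. f x * S L x)" if "finite L" for L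
  proof -
    have eq: "(\<lambda>x. f x * S L x) = (\<lambda>x. \<Sum>l\<in>L. a l * (f x * cis (of_int l * x)))"
      by (simp add: S_def sum_distrib_left mult_ac)
    moreover have int: "integrable torus (\<lambda>x. a l * (f x * cis (of_int l * x)))" for l
      using f by (intro integrable_mult_right integrable_torus_mult_cis)
    ultimately show "integrable torus (\<lambda>x. f x * S L x)"
      by simp
    show "fourier_coeff (\<lambda>x. f x * S L x) k = (\<Sum>l\<in>L. fourier_coeff f (k - l) * a l)"
      unfolding eq fourier_coeff_sum[OF that int] fourier_coeff_cmult fourier_coeff_mult_cis
      by (simp add: mult.commute)
  qed
  have "((\<lambda>L. fourier_coeff (\<lambda>x. f x * S L x) k) \<longlongrightarrow> fourier_coeff (\<lambda>x. f x * trig_series a x) k)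
    (finite_subsets_at_top UNIV)"
  proof (rule tendstoI)
    fix e :: real assume "0 < e"
    then have e: "0 < e / (I + 1)"
      using I by simp
    have "\<forall>\<^sub>F L in finite_subsets_at_top UNIV. finite L \<and> (\<forall>x\<in>UNIV. dist (S L x) (trig_series a x) < e / (I + 1))"
      using uniform_limitD[OF trig_series_uniform_limit[OF a] e]
      by (intro eventually_conj) (auto simp: S_def eventually_finite_subsets_at_top_weakI)
    then show "\<forall>\<^sub>F L in finite_subsets_at_top UNIV.
        dist (fourier_coeff (\<lambda>x. f x * S L x) k) (fourier_coeff (\<lambda>x. f x * trig_series a x) k) < e"
    proof (rule eventually_mono)
      fix L assume L: "finite L \<and> (\<forall>x\<in>UNIV. dist (S L x) (trig_series a x) < e / (I + 1))"
      have "dist (fourier_coeff (\<lambda>x. f x * S L x) k) (fourier_coeff (\<lambda>x. f x * trig_series a x) k)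
          = cmod (fourier_coeff (\<lambda>x. f x * S L x - f x * trig_series a x) k)"
        using L int1 int2 by (simp add: fourier_coeff_diff dist_norm)
      also have "\<dots> \<le> (LINT x|torus. cmod (f x * S L x - f x * trig_series a x))"
        using L int1 int2 by (intro norm_fourier_coeff_le) auto
      also have "\<dots> \<le> (LINT x|torus. e / (I + 1) * cmod (f x))"
      proof (rule integral_mono)
        fix x
        show "cmod (f x * S L x - f x * trig_series a x) \<le> e / (I + 1) * cmod (f x)"
          unfolding right_diff_distrib[symmetric] norm_mult mult.commute[of "e / (I + 1)"]
          using L by (intro mult_left_mono) (auto simp: dist_norm less_imp_le)
      qed (use L int1 int2 f in auto)
      also have "\<dots> = e / (I + 1) * I"
        by (simp add: I_def)
      also have "\<dots> < e"
        using I \<open>0 < e\<close> by (simp add: field_simps)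
      finally show "dist (fourier_coeff (\<lambda>x. f x * S L x) k) (fourier_coeff (\<lambda>x. f x * trig_series a x) k) < e" .
    qed
  qed
  moreover have "((\<lambda>L. fourier_coeff (\<lambda>x. f x * S L x) k) \<longlongrightarrow> conv (fourier_coeff f) a k) (finite_subsets_at_top UNIV)"
    using conv_has_sum[where a = "fourier_coeff f" and k = k, OF norm_fourier_coeff_le[OF f] a] unfolding has_sum_def
    by (rule Lim_transform_eventually) (auto intro!: eventually_finite_subsets_at_top_weakI simp: partial)
  ultimately show ?thesis
    by (intro tendsto_unique[of "finite_subsets_at_top UNIV"]) auto
qed

lemma fourier_coeff_trig_series:
  assumes "(\<lambda>k. cmod (a k)) summable_on UNIV"
  shows "fourier_coeff (trig_series a) k = a k"
proof -
  have "fourier_coeff (trig_series a) k = conv (fourier_coeff (\<lambda>_. 1)) a k"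
    using fourier_coeff_mult_trig_series[of "\<lambda>_. 1" a k] assms
      finite_measure.integrable_const[OF finite_measure_torus] by simp
  also have "\<dots> = (\<Sum>\<^sub>\<infinity>l. if l = k then a k else 0)"
    unfolding conv_def by (intro infsum_cong) (auto simp: fourier_coeff_const)
  also have "\<dots> = (\<Sum>\<^sub>\<infinity>l\<in>{k}. a l)"
    by (intro infsum_cong_neutral) auto
  finally show ?thesis by simp
qed

section \<open>Uniqueness of Fourier coefficients\<close>

text \<open>On the unit circle a linear functional of \<open>z\<close> is a combination of \<open>e\<^sup>i\<^sup>x\<close> and \<open>e\<^sup>-\<^sup>i\<^sup>x\<close>, and
  multiplication by these only shifts Fourier coefficients.  So vanishing coefficients are preserved
  under multiplication by every polynomial in the coordinates of \<open>z\<close>.\<close>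

lemma trig_polynomial_coeff_zero:
  fixes p :: "complex \<Rightarrow> real"
  assumes "real_polynomial_function p"
  shows "integrable torus f \<Longrightarrow> (\<And>k. fourier_coeff f k = 0) \<Longrightarrow>
    integrable torus (\<lambda>x. f x * of_real (p (cis x))) \<and>
    (\<forall>k. fourier_coeff (\<lambda>x. f x * of_real (p (cis x))) k = 0)"
  using assms
proof (induction p arbitrary: f rule: real_polynomial_function.induct)
  case (linear p)
  \<comment> \<open>\<open>p (cis x) = cos x p(1) + sin x p(\<i>)\<close>, written with \<open>e\<^sup>i\<^sup>x\<close> and \<open>e\<^sup>-\<^sup>i\<^sup>x\<close>.\<close>
  define \<alpha> \<beta> where "\<alpha> = (p 1 - \<i> * p \<i>) / 2" and "\<beta> = (p 1 + \<i> * p \<i>) / 2"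
  have "p (cis x) = cos x * p 1 + sin x * p \<i>" for x
  proof -
    interpret bounded_linear p by fact
    have "cis x = cos x *\<^sub>R 1 + sin x *\<^sub>R \<i>"
      by (simp add: complex_eq_iff)
    then show ?thesis
      by (simp only: add scale) simp
  qed
  then have "of_real (p (cis x)) = \<alpha> * cis (of_int 1 * x) + \<beta> * cis (of_int (-1) * x)" for x
    by (simp add: \<alpha>_def \<beta>_def complex_eq_iff field_simps)
  then have eq: "(\<lambda>x. f x * of_real (p (cis x)))
      = (\<lambda>x. \<alpha> * (f x * cis (of_int 1 * x)) + \<beta> * (f x * cis (of_int (-1) * x)))"
    by (simp add: algebra_simps)
  have int: "integrable torus (\<lambda>x. c * (f x * cis (of_int l * x)))" for c l
    using linear by (intro integrable_mult_right integrable_torus_mult_cis)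
  have "fourier_coeff (\<lambda>x. \<alpha> * (f x * cis (of_int 1 * x)) + \<beta> * (f x * cis (of_int (-1) * x))) k = 0" for k
    unfolding fourier_coeff_add[OF int int] fourier_coeff_cmult fourier_coeff_mult_cis
    by (simp add: linear)
  then show ?case
    unfolding eq using int by (intro conjI Bochner_Integration.integrable_add) blast+
next
  case (const c)
  then show ?case
    using fourier_coeff_cmult[of "of_real c" f] by (simp add: mult.commute)
next
  case (add p q)
  then show ?case
    by (simp add: distrib_left fourier_coeff_add)
next
  case (mult p q)
  show ?case
    using mult.IH(2)[of "\<lambda>x. f x * of_real (p (cis x))"] mult.IH(1)[OF mult.prems]
    by (simp add: mult.assoc)
qed

lemma integral_eq_fourier_coeff: "(LINT x|torus. f x) = of_real (2 * pi) * fourier_coeff f 0"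
  by (simp add: fourier_coeff_torus)

text \<open>Stone--Weierstrass on the circle extends the orthogonality from polynomials to continuous
  functions.\<close>

lemma integral_continuous_zero:
  fixes G :: "complex \<Rightarrow> real"
  assumes f: "integrable torus f" "\<And>k. fourier_coeff f k = 0" and G: "continuous_on UNIV G"
  shows "(LINT x|torus. f x * of_real (G (cis x))) = 0"
proof -
  define I where "I = (LINT x|torus. cmod (f x))"
  have I: "0 \<le> I"
    unfolding I_def by (rule Bochner_Integration.integral_nonneg) auto
  have "bounded (G ` sphere 0 1)"
    by (intro compact_imp_bounded compact_continuous_image continuous_on_subset[OF G]) auto
  then obtain B where "\<forall>y\<in>G ` sphere 0 1. norm y \<le> B"
    unfolding bounded_iff by blast
  then have B: "\<bar>G z\<bar> \<le> B" if "z \<in> sphere 0 1" for z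
    using that by fastforce
  have intG: "integrable torus (\<lambda>x. f x * of_real (G (cis x)))"
  proof (rule integrable_torus_mult_bounded[OF f(1), where B = B])
    show "(\<lambda>x. complex_of_real (G (cis x))) \<in> borel_measurable torus"
      by (intro continuous_measurable_torus continuous_intros continuous_on_compose2[OF G]) auto
  qed (use B in auto)
  have "cmod (LINT x|torus. f x * of_real (G (cis x))) \<le> 0 + e" if e: "0 < e" for e
  proof -
    have e': "0 < e / (I + 1)"
      using e I by simp
    obtain p where p: "real_polynomial_function p" "\<And>z. z \<in> sphere 0 1 \<Longrightarrow> \<bar>G z - p z\<bar> < e / (I + 1)"
      using Stone_Weierstrass_real_polynomial_function[of "sphere 0 1" G, OF _ _ e']
        continuous_on_subset[OF G] by auto
    note pz = trig_polynomial_coeff_zero[OF p(1) f]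
    have "(LINT x|torus. f x * of_real (G (cis x)))
        = (LINT x|torus. f x * of_real (G (cis x))) - (LINT x|torus. f x * of_real (p (cis x)))"
      using pz integral_eq_fourier_coeff[of "\<lambda>x. f x * of_real (p (cis x))"] by simp
    also have "\<dots> = (LINT x|torus. f x * of_real (G (cis x)) - f x * of_real (p (cis x)))"
      using pz intG by simp
    also have "cmod \<dots> \<le> (LINT x|torus. cmod (f x * of_real (G (cis x)) - f x * of_real (p (cis x))))"
      by (rule integral_norm_bound)
    also have "\<dots> \<le> (LINT x|torus. e / (I + 1) * cmod (f x))"
    proof (rule integral_mono)
      fix x
      show "cmod (f x * of_real (G (cis x)) - f x * of_real (p (cis x))) \<le> e / (I + 1) * cmod (f x)"
        unfolding right_diff_distrib[symmetric] norm_mult of_real_diff[symmetric] norm_of_real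
        using less_imp_le[OF p(2)[of "cis x"]] mult_right_mono[of "\<bar>G (cis x) - p (cis x)\<bar>" "e / (I + 1)" "cmod (f x)"]
        by (simp add: mult.commute)
    qed (use pz intG f in auto)
    also have "\<dots> = e / (I + 1) * I"
      by (simp add: I_def)
    also have "\<dots> \<le> e"
      using I e by (simp add: field_simps)
    finally show ?thesis by simp
  qed
  then have "cmod (LINT x|torus. f x * of_real (G (cis x))) \<le> 0"
    by (rule field_le_epsilon)
  then show ?thesis by simp
qed

lemma cis_eq_torus:
  assumes "cis x = cis y" "x \<in> {-pi..<pi}" "y \<in> {-pi..<pi}"
  shows "x = y"
proof -
  have "sin x = sin y \<and> cos x = cos y"
    using assms(1) by (simp add: complex_eq_iff)
  then obtain n :: int where n: "x = y + 2 * pi * n"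
    using sin_cos_eq_iff by metis
  then have "2 * pi * real_of_int n = x - y"
    by linarith
  then have "\<bar>2 * pi * real_of_int n\<bar> < 2 * pi"
    using assms(2,3) by auto
  then have "\<bar>real_of_int n\<bar> < 1"
    using mult_less_cancel_left_pos[of "2 * pi" "\<bar>real_of_int n\<bar>" 1] by (simp add: abs_mult)
  then have "n = 0" by linarith
  with n show ?thesis by simp
qed

lemma AE_torus_neq: "AE x in torus. x \<noteq> c"
proof -
  have "{c} \<in> null_sets lebesgue"
    by simp
  from AE_not_in[OF this] show ?thesis
    by (subst AE_restrict_space_iff) (auto elim!: eventually_mono)
qed

text \<open>The continuous functions \<open>max 0 (1 - n dist(z, C))\<close> decrease to the indicator of the closed arc
  \<open>C\<close>; dominated convergence passes to the limit.\<close>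

lemma integral_initial_interval_zero:
  assumes f: "integrable torus f" "\<And>k. fourier_coeff f k = 0" and a: "-pi \<le> a" "a < pi"
  shows "(LINT x|torus. indicator {..a} x *\<^sub>R f x) = 0"
proof -
  define C where "C = cis ` {-pi..a}"
  define G where "G n z = max 0 (1 - real n * infdist z C)" for n z
  have "compact C"
    unfolding C_def by (intro compact_continuous_image continuous_intros) auto
  then have C: "closed C" "C \<noteq> {}"
    using a by (auto simp: compact_imp_closed C_def)
  have Gcont: "continuous_on UNIV (G n)" for n
    unfolding G_def by (intro continuous_intros)
  have lim: "(\<lambda>n. G n z) \<longlonglongrightarrow> indicator C z" for z
  proof (cases "z \<in> C")
    case True
    then show ?thesis by (simp add: G_def)
  next
    case False
    then have pos: "0 < infdist z C"
      using C in_closed_iff_infdist_zero[of C z] infdist_nonneg[of z C] by linarith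
    have "eventually (\<lambda>n. 1 / infdist z C \<le> real n) sequentially"
      by (rule eventually_sequentiallyI[of "nat \<lceil>1 / infdist z C\<rceil>"]) linarith
    then have "eventually (\<lambda>n. G n z = indicator C z) sequentially"
      by (rule eventually_mono) (use pos False in \<open>auto simp: G_def field_simps max_def\<close>)
    then show ?thesis
      by (rule tendsto_eventually)
  qed
  have "(\<lambda>n. LINT x|torus. f x * of_real (G n (cis x))) \<longlonglongrightarrow> (LINT x|torus. indicator {..a} x *\<^sub>R f x)"
  proof (rule integral_dominated_convergence[where w = "\<lambda>x. cmod (f x)"])
    show "AE x in torus. (\<lambda>n. f x * of_real (G n (cis x))) \<longlonglongrightarrow> indicator {..a} x *\<^sub>R f x"
      using AE_torus_neq[of pi] AE_space
    proof eventually_elim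
      case (elim x)
      have "cis x \<in> C \<longleftrightarrow> x \<le> a"
      proof
        assume "cis x \<in> C"
        then obtain y where "cis x = cis y" "y \<in> {-pi..a}"
          by (auto simp: C_def)
        with elim a cis_eq_torus[of x y] show "x \<le> a"
          by auto
      qed (use elim in \<open>auto simp: C_def\<close>)
      moreover have "(\<lambda>n. f x * of_real (G n (cis x))) \<longlonglongrightarrow> f x * of_real (indicator C (cis x))"
        by (intro tendsto_intros lim)
      ultimately show ?case
        by (auto simp: indicator_def split: if_splits)
    qed
    show "AE x in torus. cmod (f x * of_real (G n (cis x))) \<le> cmod (f x)" for n
      by (auto intro!: AE_I2 mult_right_le_one_le simp: norm_mult G_def infdist_nonneg)
    show "(\<lambda>x. f x * of_real (G n (cis x))) \<in> borel_measurable torus" for n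
      using borel_measurable_integrable[OF f(1)]
    proof (rule borel_measurable_times)
      show "(\<lambda>x. complex_of_real (G n (cis x))) \<in> borel_measurable torus"
        by (intro continuous_measurable_torus continuous_intros continuous_on_compose2[OF Gcont]) auto
    qed
    show "(\<lambda>x. indicator {..a} x *\<^sub>R f x) \<in> borel_measurable torus"
    proof -
      have "(indicator {..a} :: real \<Rightarrow> real) \<in> borel_measurable torus"
        by (intro borel_measurable_torus borel_measurable_indicator) auto
      then show ?thesis
        using f(1) by (intro borel_measurable_scaleR) auto
    qed
  qed (use f(1) in auto)
  moreover have "(LINT x|torus. f x * of_real (G n (cis x))) = 0" for n
    by (rule integral_continuous_zero[OF f Gcont])
  ultimately show ?thesis
    by (simp add: LIMSEQ_const_iff)
qed

text \<open>The integrals of \<open>f\<close> over the half-lines \<open>{..a}\<close> vanish, and these generate the Borel sets; by a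
  Dynkin argument the integral over every measurable set vanishes.\<close>

theorem fourier_uniqueness:
  assumes f: "integrable torus f" "\<And>k. fourier_coeff f k = 0"
  shows "AE x in torus. f x = 0"
proof -
  define h where "h x = indicat_real {-pi..pi} x *\<^sub>R f x" for x
  have h: "integrable lebesgue h"
    using f(1) by (simp add: integrable_torus_iff set_integrable_def h_def[abs_def])
  have ind: "integrable lebesgue (\<lambda>x. indicat_real A x *\<^sub>R h x)" if "A \<in> sets lebesgue" for A
    using that h by (rule integrable_mult_indicator)
  have tor: "(LINT x|lebesgue. indicat_real A x *\<^sub>R h x) = (LINT x|torus. indicat_real A x *\<^sub>R f x)" for A
    by (simp add: integral_restrict_space h_def mult.commute[of "indicat_real A _"])
  have total: "(LINT x|lebesgue. h x) = 0"
    using tor[of UNIV] integral_eq_fourier_coeff[of f] f(2) by simp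
  have gen: "sets borel = sigma_sets UNIV (range (\<lambda>a::real. {..a}))"
    unfolding borel_eq_atMost by simp
  have borel: "(LINT x:A|lebesgue. h x) = 0" if "A \<in> sets borel" for A
  proof -
    have "Int_stable (range (\<lambda>a::real. {..a}))" "range (\<lambda>a::real. {..a}) \<subseteq> Pow UNIV"
      by (auto simp: Int_stable_def)
    from this that[unfolded gen] show ?thesis
      unfolding set_lebesgue_integral_def
    proof (induction A rule: sigma_sets_induct_disjoint)
      case (basic A)
      then obtain a where a: "A = {..a}" by auto
      consider "a < -pi" | "-pi \<le> a" "a < pi" | "pi \<le> a" by linarith
      then show ?case
      proof cases
        case 1
        then have "(\<lambda>x. indicat_real A x *\<^sub>R h x) = (\<lambda>x. 0)"
          by (auto simp: a h_def indicator_def)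
        then show ?thesis by simp
      next
        case 2
        then show ?thesis
          unfolding tor a by (rule integral_initial_interval_zero[OF f])
      next
        case 3
        then have "(\<lambda>x. indicat_real A x *\<^sub>R h x) = h"
          by (auto simp: a h_def indicator_def)
        then show ?thesis using total by simp
      qed
    next
      case (compl A)
      then have A: "A \<in> sets lebesgue"
        unfolding gen[symmetric] by auto
      have "(\<lambda>x. indicat_real (UNIV - A) x *\<^sub>R h x) = (\<lambda>x. h x - indicat_real A x *\<^sub>R h x)"
        by (auto simp: indicator_def)
      then show ?case
        using compl(2) total h ind[OF A] by simp
    next
      case (union A)
      then have A: "A i \<in> sets lebesgue" for i
        unfolding gen[symmetric] by auto
      have "(LINT x:(\<Union>i. A i)|lebesgue. h x) = (\<Sum>i. LINT x:A i|lebesgue. h x)"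
      proof (rule lebesgue_integral_countable_add)
        show "set_integrable lebesgue (\<Union>i. A i) h"
          unfolding set_integrable_def using A by (intro ind) auto
      qed (use A union(1) in \<open>auto simp: disjoint_family_on_def\<close>)
      then show ?case
        using union(3) by (simp add: set_lebesgue_integral_def)
    qed auto
  qed
  interpret finite_measure torus
    by (rule finite_measure_torus)
  show ?thesis
  proof (rule density_unique_banach[OF f(1)])
    fix A assume "A \<in> sets torus"
    then have A: "A \<in> sets lebesgue"
      by (auto simp: sets_restrict_space)
    \<comment> \<open>A Lebesgue set is a Borel set up to a null set.\<close>
    then obtain C N where CN: "fsigma C" "N \<in> null_sets lebesgue" "C \<union> N = A"
      using lebesgue_set_almost_fsigma by metis
    have C: "C \<in> sets borel"
      using CN(1) by (auto elim!: fsigma.cases)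
    have "(LINT x:A|lebesgue. h x) = (LINT x:C|lebesgue. h x)"
      unfolding set_lebesgue_integral_def
    proof (rule integral_cong_AE)
      show "AE x in lebesgue. indicat_real A x *\<^sub>R h x = indicat_real C x *\<^sub>R h x"
        using AE_not_in[OF CN(2)] by (rule eventually_mono) (use CN(3) in \<open>auto simp: indicator_def\<close>)
      show "(\<lambda>x. indicat_real C x *\<^sub>R h x) \<in> borel_measurable lebesgue"
        using C by (intro borel_measurable_integrable ind) auto
    qed (use A ind in auto)
    then show "(LINT x:A|torus. f x) = (LINT x:A|torus. 0)"
      using borel[OF C] tor[of A] by (simp add: set_lebesgue_integral_def)
  qed simp
qed

section \<open>Sobolev functions and the cubic nonlinearity\<close>

abbreviation sobolev_term :: "real \<Rightarrow> (real \<Rightarrow> complex) \<Rightarrow> int \<Rightarrow> real" where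
  "sobolev_term \<sigma> f k \<equiv> (1 + (of_int k)\<^sup>2) powr \<sigma> * (cmod (fourier_coeff f k))\<^sup>2"

text \<open>The two weights are comparable because \<open>(1 + |k|)\<^sup>2 \<le> 2 (1 + k\<^sup>2)\<close>.\<close>

lemma weighted_l2_sobolev_norm:
  assumes "sobolev_term \<sigma> f summable_on UNIV" "0 \<le> \<sigma>"
  shows "weighted_l2 \<sigma> (fourier_coeff f) (sqrt (2 powr \<sigma>) * sobolev_norm \<sigma> f)"
  unfolding weighted_l2_def
proof safe
  fix K :: "int set" assume K: "finite K"
  have "(wgt \<sigma> k * cmod (fourier_coeff f k))\<^sup>2 \<le> 2 powr \<sigma> * sobolev_term \<sigma> f k" for k
  proof -
    have "(wgt \<sigma> k)\<^sup>2 = ((1 + \<bar>real_of_int k\<bar>)\<^sup>2) powr \<sigma>"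
      by (simp add: wgt_def power2_eq_square powr_mult)
    also have "\<dots> \<le> (2 * (1 + (real_of_int k)\<^sup>2)) powr \<sigma>"
      using assms(2) sum_squares_bound[of 1 "\<bar>real_of_int k\<bar>"]
      by (intro powr_mono2) (auto simp: power2_sum)
    also have "\<dots> = 2 powr \<sigma> * (1 + (real_of_int k)\<^sup>2) powr \<sigma>"
      by (rule powr_mult)
    finally show ?thesis
      by (simp add: power_mult_distrib mult_right_mono flip: mult.assoc)
  qed
  then have "(\<Sum>k\<in>K. (wgt \<sigma> k * cmod (fourier_coeff f k))\<^sup>2) \<le> (\<Sum>k\<in>K. 2 powr \<sigma> * sobolev_term \<sigma> f k)"
    by (intro sum_mono)
  also have "\<dots> = 2 powr \<sigma> * (\<Sum>k\<in>K. sobolev_term \<sigma> f k)"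
    by (simp add: sum_distrib_left)
  also have "\<dots> \<le> 2 powr \<sigma> * (\<Sum>\<^sub>\<infinity>k. sobolev_term \<sigma> f k)"
    using assms(1) K by (intro mult_left_mono finite_sum_le_infsum) auto
  finally show "L2_set (\<lambda>k. wgt \<sigma> k * cmod (fourier_coeff f k)) K \<le> sqrt (2 powr \<sigma>) * sobolev_norm \<sigma> f"
    unfolding L2_set_def sobolev_norm_def real_sqrt_mult[symmetric] by (rule real_sqrt_le_mono)
qed

lemma L2_periodic_integrable:
  assumes "u \<in> L2_periodic"
  shows "integrable torus u"
proof (rule Bochner_Integration.integrable_bound)
  show "integrable torus (\<lambda>x. 1 + (cmod (u x))\<^sup>2)"
    using assms finite_measure.integrable_const[OF finite_measure_torus]
    by (intro Bochner_Integration.integrable_add) (auto simp: L2_periodic_def integrable_torus_iff)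
  show "u \<in> borel_measurable torus"
    using assms by (intro borel_measurable_torus) (auto simp: L2_periodic_def)
  have "cmod (u x) \<le> 1 + (cmod (u x))\<^sup>2" for x
  proof -
    have "2 * cmod (u x) \<le> 1 + (cmod (u x))\<^sup>2"
      using sum_squares_bound[of 1 "cmod (u x)"] by simp
    then show ?thesis
      using norm_ge_zero[of "u x"] by linarith
  qed
  then show "AE x in torus. norm (u x) \<le> norm (1 + (cmod (u x))\<^sup>2)"
    by (intro AE_I2) simp
qed

text \<open>The value of \<open>sobolev_norm\<close> carries information only when its series converges, so this is needed
  before the norm of a difference can be used.\<close>

lemma sobolev_diff_summable:
  assumes "u \<in> sobolev \<sigma>" "v \<in> sobolev \<sigma>"
  shows "sobolev_term \<sigma> (\<lambda>x. u x - v x) summable_on UNIV"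
proof (rule summable_on_comparison_test)
  show "(\<lambda>k. 2 * sobolev_term \<sigma> u k + 2 * sobolev_term \<sigma> v k) summable_on UNIV"
    using assms by (intro summable_on_add summable_on_cmult_right) (auto simp: sobolev_def)
  fix k
  have "(cmod (fourier_coeff u k - fourier_coeff v k))\<^sup>2 \<le> (cmod (fourier_coeff u k) + cmod (fourier_coeff v k))\<^sup>2"
    by (intro power_mono norm_triangle_ineq4) auto
  also have "\<dots> \<le> 2 * (cmod (fourier_coeff u k))\<^sup>2 + 2 * (cmod (fourier_coeff v k))\<^sup>2"
    using sum_squares_bound[of "cmod (fourier_coeff u k)" "cmod (fourier_coeff v k)"]
    by (simp add: power2_sum)
  finally have "(1 + (of_int k)\<^sup>2) powr \<sigma> * (cmod (fourier_coeff u k - fourier_coeff v k))\<^sup>2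
      \<le> (1 + (of_int k)\<^sup>2) powr \<sigma> * (2 * (cmod (fourier_coeff u k))\<^sup>2 + 2 * (cmod (fourier_coeff v k))\<^sup>2)"
    by (intro mult_left_mono) auto
  then show "sobolev_term \<sigma> (\<lambda>x. u x - v x) k \<le> 2 * sobolev_term \<sigma> u k + 2 * sobolev_term \<sigma> v k"
    using assms by (simp add: fourier_coeff_diff L2_periodic_integrable sobolev_def algebra_simps)
qed auto

text \<open>By uniqueness \<open>u\<close> agrees almost everywhere with its Fourier series \<open>S\<close>, which is bounded and
  continuous.  The product \<open>|S|\<^sup>2 S\<close> of \<open>S\<close>, \<open>S\<close> and the conjugate of \<open>S\<close> is then computed one
  factor at a time; conjugation reflects the coefficients.\<close>

lemma fourier_coeff_cubic:
  assumes u: "u \<in> L2_periodic" and sum: "(\<lambda>k. cmod (fourier_coeff u k)) summable_on UNIV"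
  shows "fourier_coeff (\<lambda>x. of_real ((cmod (u x))\<^sup>2) * u x) k
    = conv (conv (\<lambda>k. cnj (fourier_coeff u (- k))) (fourier_coeff u)) (fourier_coeff u) k"
proof -
  define S where "S = trig_series (fourier_coeff u)"
  have Scont: "continuous_on UNIV S"
    unfolding S_def using sum by (rule continuous_trig_series)
  have [measurable]: "S \<in> borel_measurable torus" "u \<in> borel_measurable torus"
    using continuous_measurable_torus[OF Scont] borel_measurable_integrable[OF L2_periodic_integrable[OF u]]
    by auto
  have Sb: "cmod (S x) \<le> (\<Sum>\<^sub>\<infinity>k. cmod (fourier_coeff u k))" for x
    unfolding S_def using sum by (rule norm_trig_series_le)
  have const: "integrable torus (\<lambda>_. 1 :: complex)"
    by (rule finite_measure.integrable_const[OF finite_measure_torus])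
  have mult_S: "integrable torus (\<lambda>x. f x * S x)" if "integrable torus f" for f
    using that by (rule integrable_torus_mult_bounded[OF _ _ Sb]) simp
  have Sint: "integrable torus S"
    using mult_S[OF const] by simp
  have Cint: "integrable torus (\<lambda>x. cnj (S x))"
    using Sint by simp
  have CSint: "integrable torus (\<lambda>x. cnj (S x) * S x)"
    using Cint by (rule mult_S)
  have "AE x in torus. u x - S x = 0"
  proof (rule fourier_uniqueness)
    show "integrable torus (\<lambda>x. u x - S x)"
      using L2_periodic_integrable[OF u] Sint by simp
    show "fourier_coeff (\<lambda>x. u x - S x) k = 0" for k
      using L2_periodic_integrable[OF u] Sint sum
      by (simp add: fourier_coeff_diff) (simp add: S_def fourier_coeff_trig_series)
  qed
  then have "AE x in torus. of_real ((cmod (u x))\<^sup>2) * u x = cnj (S x) * S x * S x"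
    by (rule eventually_mono) (simp add: complex_norm_square mult.commute[of "S _" "cnj _"] del: of_real_power)
  then have "fourier_coeff (\<lambda>x. of_real ((cmod (u x))\<^sup>2) * u x) k = fourier_coeff (\<lambda>x. cnj (S x) * S x * S x) k"
    using borel_measurable_integrable[OF mult_S[OF CSint]] by (intro fourier_coeff_cong_AE) auto
  also have "\<dots> = conv (fourier_coeff (\<lambda>x. cnj (S x) * S x)) (fourier_coeff u) k"
    by (rule fourier_coeff_mult_trig_series[OF CSint sum, folded S_def])
  also have "fourier_coeff (\<lambda>x. cnj (S x) * S x) = conv (fourier_coeff (\<lambda>x. cnj (S x))) (fourier_coeff u)"
    by (rule ext) (rule fourier_coeff_mult_trig_series[OF Cint sum, folded S_def])
  also have "fourier_coeff (\<lambda>x. cnj (S x)) = (\<lambda>k. cnj (fourier_coeff u (- k)))"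
    by (rule ext) (simp only: fourier_coeff_cnj S_def fourier_coeff_trig_series[OF sum])
  finally show ?thesis .
qed

section \<open>Nonexistence of solutions with constant data\<close>

text \<open>A solution would make \<open>\<xi> V\<close> an element of \<open>H\<^sup>\<sigma>\<^sup>-\<^sup>2\<close>, where \<open>V\<close> is its integral over a short time
  interval.  As \<open>V\<close> is close to a non-zero constant, it can be divided out by the Neumann series, and
  \<open>\<xi>\<close> itself would be in \<open>H\<^sup>\<sigma>\<^sup>-\<^sup>2\<close>.\<close>

lemma no_duhamel_solution_constant_data:
  assumes \<xi>: "\<And>k. cmod (dist_coeff \<xi> k) \<le> X" "\<And>B. \<not> weighted_l2 (\<sigma> - 2) (dist_coeff \<xi>) B"
    and \<sigma>: "3 / 2 \<le> \<sigma>" and \<delta>: "0 < \<delta>"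
  shows "\<not> duhamel_solution \<xi> lam \<sigma> (\<lambda>_. of_real \<delta>) u"
proof
  assume sol: "duhamel_solution \<xi> lam \<sigma> (\<lambda>_. of_real \<delta>) u"
  define m where "m = \<sigma> - 2"
  define a where "a t = fourier_coeff (u t)" for t
  define x where "x = dist_coeff \<xi>"
  define D where "D = sqrt (2 powr \<sigma>)"
  have duh: "a t k = schrodinger_group t (fourier_coeff (\<lambda>_. of_real \<delta>)) k +
        \<i> * integral {0..t} (\<lambda>\<rho>. schrodinger_group (t - \<rho>) (forcing_coeff \<xi> lam (u \<rho>)) k)" if "t \<in> {0..1}" for t k
    using sol that unfolding duhamel_solution_def a_def by blast
  have sob: "u t \<in> sobolev \<sigma>" if "t \<in> {0..1}" for t
    using sol that by (auto simp: duhamel_solution_def continuous_curve_def)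
  have L2: "u t \<in> L2_periodic" if "t \<in> {0..1}" for t
    using sob[OF that] by (simp add: sobolev_def)
  have a0: "a 0 k = (if k = 0 then of_real \<delta> else 0)" for k
    using duh[of 0 k] by (simp add: schrodinger_group_def fourier_coeff_const)
  obtain C where C: "0 \<le> C" "\<And>a B. weighted_l2 \<sigma> a B \<Longrightarrow> weighted_l1 \<bar>m\<bar> a (C * B)"
  proof -
    \<comment> \<open>For \<open>\<sigma> < 2\<close> the exponent \<open>m\<close> is negative and this amounts to \<open>\<sigma> > 5/4\<close>.\<close>
    have "\<bar>m\<bar> + 1 / 2 < \<sigma>"
      using \<sigma> unfolding m_def by linarith
    from weighted_l1_of_weighted_l2[OF this] that show ?thesis by blast
  qed
  have D: "0 \<le> D" by (simp add: D_def)
  have diff: "weighted_l2 \<sigma> (\<lambda>k. a \<tau> k - a t k) (D * sobolev_norm \<sigma> (\<lambda>x. u \<tau> x - u t x))"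
    if "\<tau> \<in> {0..1}" "t \<in> {0..1}" for \<tau> t
  proof -
    have "fourier_coeff (\<lambda>x. u \<tau> x - u t x) = (\<lambda>k. a \<tau> k - a t k)"
      using L2 that by (auto simp: a_def fourier_coeff_diff L2_periodic_integrable)
    then show ?thesis
      using weighted_l2_sobolev_norm[OF sobolev_diff_summable[OF sob[OF that(1)] sob[OF that(2)]]] \<sigma>
      by (simp add: D_def)
  qed
  have acont: "continuous_on {0..1} (\<lambda>t. a t k)" for k
    unfolding continuous_on_def
  proof safe
    fix t :: real assume t: "t \<in> {0..1}"
    have "((\<lambda>\<tau>. wgt (- \<sigma>) k * (D * sobolev_norm \<sigma> (\<lambda>x. u \<tau> x - u t x))) \<longlongrightarrow> wgt (- \<sigma>) k * (D * 0)) (at t within {0..1})"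
      using sol t by (intro tendsto_mult_left) (auto simp: duhamel_solution_def continuous_curve_def)
    then have lim: "((\<lambda>\<tau>. wgt (- \<sigma>) k * (D * sobolev_norm \<sigma> (\<lambda>x. u \<tau> x - u t x))) \<longlongrightarrow> 0) (at t within {0..1})"
      by simp
    have "\<forall>\<^sub>F \<tau> in at t within {0..1}. norm (a \<tau> k - a t k) \<le> wgt (- \<sigma>) k * (D * sobolev_norm \<sigma> (\<lambda>x. u \<tau> x - u t x))"
      using weighted_l2_pointwise[OF diff[OF _ t]] by (auto simp: eventually_at_filter)
    from Lim_null_comparison[OF this lim] show "((\<lambda>t. a t k) \<longlongrightarrow> a t k) (at t within {0..1})"
      by (rule LIM_zero_cancel)
  qed
  \<comment> \<open>Small enough for the relative error \<open>E\<close> to have weighted \<open>l\<^sup>1\<close> norm at most \<open>1/2\<close>.\<close>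
  define \<eta> where "\<eta> = \<delta> / (2 * (C * D + 1))"
  have \<eta>: "0 < \<eta>" "C * (D * \<eta>) \<le> \<delta> / 2"
    using C(1) D \<delta> by (auto simp: \<eta>_def field_simps add_pos_nonneg)
  have "\<forall>\<^sub>F \<tau> in at 0 within {0..1}. sobolev_norm \<sigma> (\<lambda>x. u \<tau> x - u 0 x) < \<eta>"
    using sol \<eta>(1) by (intro order_tendstoD(2)[where y = 0]) (auto simp: duhamel_solution_def continuous_curve_def)
  then obtain d where d: "0 < d" "\<And>\<tau>. \<tau> \<in> {0..1} \<Longrightarrow> \<tau> \<noteq> 0 \<Longrightarrow> \<bar>\<tau>\<bar> < d \<Longrightarrow> sobolev_norm \<sigma> (\<lambda>x. u \<tau> x - u 0 x) < \<eta>"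
    by (auto simp: eventually_at dist_real_def)
  \<comment> \<open>On \<open>[0,T]\<close> the solution stays within \<open>\<eta>\<close> of the datum.\<close>
  define T where "T = min 1 (d / 2)"
  have T: "0 < T" "T \<le> 1" "T < d"
    using d(1) by (auto simp: T_def)
  have acontT: "continuous_on {0..T} (\<lambda>t. a t k)" for k
    using T by (intro continuous_on_subset[OF acont]) auto
  have close: "weighted_l2 \<sigma> (\<lambda>k. a t k - a 0 k) (D * \<eta>)" if t: "t \<in> {0..T}" for t
  proof (rule weighted_l2_mono_bound)
    show "weighted_l2 \<sigma> (\<lambda>k. a t k - a 0 k) (D * sobolev_norm \<sigma> (\<lambda>x. u t x - u 0 x))"
      using t T by (intro diff) auto
    have "sobolev_norm \<sigma> (\<lambda>x. u t x - u 0 x) \<le> \<eta>"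
    proof (cases "t = 0")
      case True
      then show ?thesis
        using \<eta>(1) by (simp add: sobolev_norm_def fourier_coeff_const)
    next
      case False
      then show ?thesis
        using t T by (intro less_imp_le d(2)) auto
    qed
    then show "D * sobolev_norm \<sigma> (\<lambda>x. u t x - u 0 x) \<le> D * \<eta>"
      using D by (rule mult_left_mono)
  qed
  define B where "B = D * \<eta> + \<delta>"
  have B: "0 \<le> B"
    using D \<eta>(1) \<delta> by (simp add: B_def)
  have "weighted_l2 \<sigma> (a 0) \<delta>"
    unfolding weighted_l2_def L2_set_def
  proof safe
    fix K :: "int set" assume K: "finite K"
    have "(\<Sum>k\<in>K. (wgt \<sigma> k * cmod (a 0 k))\<^sup>2) = (\<Sum>k\<in>K. if k = 0 then \<delta>\<^sup>2 else 0)"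
      by (intro sum.cong) (auto simp: a0 wgt_def)
    also have "\<dots> \<le> \<delta>\<^sup>2"
      using K by (simp add: sum.delta)
    finally show "sqrt (\<Sum>k\<in>K. (wgt \<sigma> k * cmod (a 0 k))\<^sup>2) \<le> \<delta>"
      using \<delta> by (intro real_le_lsqrt) auto
  qed
  then have aB: "weighted_l2 \<sigma> (a t) B" if t: "t \<in> {0..T}" for t
    using weighted_l2_add[OF close[OF t], of "a 0" \<delta>] by (simp add: B_def)
  have a1: "weighted_l1 \<bar>m\<bar> (a t) (C * B)" if t: "t \<in> {0..T}" for t
    using C(2)[OF aB[OF t]] .
  have asum: "(\<lambda>k. cmod (a t k)) summable_on UNIV" "(\<Sum>\<^sub>\<infinity>k. cmod (a t k)) \<le> C * B" if t: "t \<in> {0..T}" for t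
    using weighted_l1_summable[OF a1[OF t]] weighted_l1_infsum_le[OF a1[OF t]] by auto
  have apt: "cmod (a t k) \<le> wgt (- \<sigma>) k * B" if t: "t \<in> {0..T}" for t k
    using weighted_l2_pointwise[OF aB[OF t]] .
  have Msum: "(\<lambda>k. wgt (- \<sigma>) k * B) summable_on UNIV"
    using \<sigma> by (intro summable_on_cmult_left wgt_summable) auto
  have a_le: "cmod (a t k) \<le> B" if t: "t \<in> {0..T}" for t k
  proof -
    have "wgt (- \<sigma>) k \<le> wgt 0 k"
      using \<sigma> by (intro wgt_mono) auto
    then show ?thesis
      using apt[OF t, of k] mult_right_mono[of "wgt (- \<sigma>) k" 1 B] B by simp
  qed
  define b where "b t k = cnj (a t (- k))" for t k
  have b_le: "cmod (b t k) \<le> B" if t: "t \<in> {0..T}" for t k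
    using a_le[OF t] by (simp add: b_def)
  define N2 where "N2 t = conv (b t) (a t)" for t
  define N where "N t = conv (N2 t) (a t)" for t
  have N2_le: "cmod (N2 t k) \<le> B * (C * B)" if t: "t \<in> {0..T}" for t k
  proof -
    have "cmod (N2 t k) \<le> B * (\<Sum>\<^sub>\<infinity>l. cmod (a t l))"
      unfolding N2_def by (rule norm_conv_le[OF b_le[OF t] asum(1)[OF t]])
    also have "\<dots> \<le> B * (C * B)"
      using asum(2)[OF t] B by (rule mult_left_mono)
    finally show ?thesis .
  qed
  have bcont: "continuous_on {0..T} (\<lambda>t. b t k)" for k
    unfolding b_def by (intro continuous_intros acontT)
  have N2cont: "continuous_on {0..T} (\<lambda>t. N2 t k)" for k
    unfolding N2_def using B
    by (intro conv_continuous_on[OF b_le apt Msum _ bcont acontT])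
  have Ncont: "continuous_on {0..T} (\<lambda>t. N t k)" for k
    unfolding N_def using B C(1)
    by (intro conv_continuous_on[OF N2_le apt Msum _ N2cont acontT]) auto
  have m\<sigma>: "m \<le> \<sigma>" by (simp add: m_def)
  have N_l2: "weighted_l2 m (N t) (B * (C * B) * (C * B))" if t: "t \<in> {0..T}" for t
    unfolding N_def
  proof (rule weighted_l2_conv[OF _ N2_le[OF t] a1[OF t]])
    have "weighted_l2 m (b t) B"
      using weighted_l2_mono[OF weighted_l2_reflect[OF aB[OF t]] m\<sigma>] by (simp add: b_def[abs_def])
    then show "weighted_l2 m (N2 t) (B * (C * B))"
      unfolding N2_def by (rule weighted_l2_conv[OF _ b_le[OF t] a1[OF t]])
  qed
  have X: "cmod (x k) \<le> X" for k
    using \<xi>(1) by (simp add: x_def)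
  have forcing: "forcing_coeff \<xi> lam (u t) k = conv x (a t) k - of_real lam * N t k" if t: "t \<in> {0..T}" for t k
    using fourier_coeff_cubic[OF L2[of t]] asum(1)[OF t] t T
    unfolding forcing_coeff_def mult_coeff_def conv_def[symmetric] x_def[symmetric] a_def[symmetric]
    by (simp add: N_def N2_def b_def[abs_def] a_def[symmetric])
  have X0: "0 \<le> X"
    using order_trans[OF norm_ge_zero X] .
  have xacont: "continuous_on {0..T} (\<lambda>t. conv x (a t) k)" for k
    using X X0 by (intro conv_continuous_on[OF _ apt Msum _ _ acontT, where a = "\<lambda>_. x"]) auto
  define V where "V k = integral {0..T} (\<lambda>t. a t k)" for k
  define G where "G k = integral {0..T} (\<lambda>t. N t k)" for k
  have intF: "integral {0..T} (\<lambda>t. forcing_coeff \<xi> lam (u t) k) = conv x V k - of_real lam * G k" for k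
  proof -
    have "integral {0..T} (\<lambda>t. forcing_coeff \<xi> lam (u t) k)
        = integral {0..T} (\<lambda>t. conv x (a t) k - of_real lam * N t k)"
      by (intro integral_cong forcing)
    also have "\<dots> = integral {0..T} (\<lambda>t. conv x (a t) k) - integral {0..T} (\<lambda>t. of_real lam * N t k)"
      by (intro integral_diff integrable_continuous_real continuous_intros xacont Ncont)
    also have "integral {0..T} (\<lambda>t. conv x (a t) k) = conv x V k"
      unfolding V_def using T by (intro conv_integral[OF X apt Msum acontT]) auto
    also have "integral {0..T} (\<lambda>t. of_real lam * N t k) = of_real lam * G k"
      unfolding G_def by (rule integral_mult_right)
    finally show ?thesis .
  qed
  \<comment> \<open>The differences are written as sums with scalar factors so that the closure rules for \<open>weighted_l2\<close> apply literally.\<close>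
  have key: "conv x V k = of_real ((of_int k)\<^sup>2) * V k + (- \<i>) * (a T k + (- 1) * a 0 k) + of_real lam * G k" for k
  proof -
    have "integral {0..T} (\<lambda>t. forcing_coeff \<xi> lam (u t) k)
        = of_real ((of_int k)\<^sup>2) * integral {0..T} (\<lambda>t. a t k) - \<i> * (a T k - a 0 k)"
    proof (rule duhamel_time_average)
      show "continuous_on {0..T} (\<lambda>t. forcing_coeff \<xi> lam (u t) k)"
        using forcing by (subst continuous_on_cong[OF refl]) (auto intro!: continuous_intros xacont Ncont)
      show "a t k = cis (- t * (of_int k)\<^sup>2) * fourier_coeff (\<lambda>_. of_real \<delta>) k +
        \<i> * integral {0..t} (\<lambda>\<rho>. cis (- (t - \<rho>) * (of_int k)\<^sup>2) * forcing_coeff \<xi> lam (u \<rho>) k)" if "t \<in> {0..T}" for t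
        using duh[of t k] that T by (simp add: schrodinger_group_def)
    qed (use T in auto)
    then show ?thesis
      unfolding intF V_def[symmetric] by (simp add: algebra_simps)
  qed
  have V2: "weighted_l2 \<sigma> V (T * B)"
    unfolding V_def[abs_def] using T by (intro weighted_l2_integral acontT aB) auto
  have "\<exists>B'. weighted_l2 m (conv x V) B'"
  proof -
    have 1: "weighted_l2 m (\<lambda>k. of_real ((of_int k)\<^sup>2) * V k) (T * B)"
    proof (rule weighted_l2_subst[OF V2, where r = 2])
      show "cmod (of_real ((of_int k)\<^sup>2) * V k) \<le> wgt 2 k * cmod (V k)" for k
      proof -
        have "(real_of_int k)\<^sup>2 \<le> (1 + \<bar>real_of_int k\<bar>)\<^sup>2"
          by (subst abs_le_square_iff[symmetric]) auto
        then show ?thesis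
          by (auto simp: norm_mult norm_power wgt_def powr_numeral intro!: mult_right_mono)
      qed
    qed (simp add: m_def)
    have 2: "weighted_l2 m (\<lambda>k. (- \<i>) * (a T k + (- 1) * a 0 k)) (cmod (- \<i>) * (B + cmod (- 1) * B))"
      using T by (intro weighted_l2_scale weighted_l2_add weighted_l2_mono[OF aB m\<sigma>]) auto
    have 3: "weighted_l2 m (\<lambda>k. of_real lam * G k) (cmod (of_real lam) * (T * (B * (C * B) * (C * B))))"
      unfolding G_def using T by (intro weighted_l2_scale weighted_l2_integral Ncont N_l2) auto
    show ?thesis
      using weighted_l2_add[OF weighted_l2_add[OF 1 2] 3] unfolding key[abs_def] by (rule exI)
  qed
  then obtain B' where B': "weighted_l2 m (conv x V) B'" ..
  define c where "c = complex_of_real (1 / (T * \<delta>))"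
  define E where "E k = (if k = 0 then 1 else 0) + (- c) * V k" for k :: int
  have E: "weighted_l1 \<bar>m\<bar> E (1 / 2)"
  proof -
    have "weighted_l1 \<bar>m\<bar> (\<lambda>k. integral {0..T} (\<lambda>t. a t k - a 0 k)) (T * (C * (D * \<eta>)))"
      using T by (intro weighted_l1_integral continuous_intros acontT C(2) close) auto
    then have "weighted_l1 \<bar>m\<bar> (\<lambda>k. (- c) * integral {0..T} (\<lambda>t. a t k - a 0 k)) (cmod (- c) * (T * (C * (D * \<eta>))))"
      by (rule weighted_l1_scale)
    moreover have "(- c) * integral {0..T} (\<lambda>t. a t k - a 0 k) = E k" for k
    proof -
      have "integral {0..T} (\<lambda>t. a t k - a 0 k) = V k - of_real T * a 0 k"
        unfolding V_def using T
        by (subst integral_diff) (auto intro!: integrable_continuous_real acontT simp: scaleR_conv_of_real)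
      then show ?thesis
        using T \<delta> by (auto simp: E_def c_def a0 field_simps)
    qed
    moreover have "cmod (- c) * (T * (C * (D * \<eta>))) \<le> 1 / 2"
    proof -
      have "cmod (- c) = 1 / (T * \<delta>)"
        unfolding c_def norm_minus_cancel norm_of_real using T \<delta> by simp
      then have "cmod (- c) * (T * (C * (D * \<eta>))) = C * (D * \<eta>) / \<delta>"
        using T by simp
      also have "\<dots> \<le> 1 / 2"
        using \<delta> \<eta>(2) by (simp add: field_simps)
      finally show ?thesis .
    qed
    ultimately show ?thesis
      using weighted_l1_mono_bound by auto
  qed
  have Vsum: "(\<lambda>k. cmod (V k)) summable_on UNIV"
    using weighted_l1_summable[OF C(2)[OF V2]] by simp
  have "x k = c * conv x V k + conv x E k" for k
    unfolding E_def[abs_def] conv_delta_add_right[OF X Vsum] by simp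
  moreover have "weighted_l2 m (\<lambda>k. c * conv x V k) (cmod c * B')"
    using B' by (rule weighted_l2_scale)
  ultimately have "weighted_l2 m x (2 * (cmod c * B'))"
    by (intro neumann_regularity[OF X _ E])
  then show False
    using \<xi>(2) by (simp add: m_def x_def)
qed

section \<open>Periodic distributions with prescribed Fourier coefficients\<close>

lemma fourier_coeff_continuous:
  assumes "continuous_on UNIV f"
  shows "integrable torus f"
    and "fourier_coeff f k = integral {-pi..pi} (\<lambda>x. f x * cis (- (of_int k * x))) / of_real (2 * pi)"
proof -
  have int: "integrable torus g" if "continuous_on UNIV g" for g :: "real \<Rightarrow> complex"
    unfolding integrable_torus_iff using that
    by (intro absolutely_integrable_continuous_real continuous_on_subset[OF that]) auto
  show "integrable torus f"
    using assms by (rule int)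
  have "set_integrable lebesgue {-pi..pi} (\<lambda>x. f x * cis (- (of_int k * x)))"
    unfolding integrable_torus_iff[symmetric] by (intro int continuous_intros assms)
  then show "fourier_coeff f k = integral {-pi..pi} (\<lambda>x. f x * cis (- (of_int k * x))) / of_real (2 * pi)"
    unfolding fourier_coeff_def by (subst set_lebesgue_integral_eq_integral(2)) auto
qed

lemma fourier_coeff_derivative:
  assumes f: "\<And>x. (f has_vector_derivative f' x) (at x)" and f': "continuous_on UNIV f'"
    and per: "f pi = f (- pi)"
  shows "fourier_coeff f' k = \<i> * of_int k * fourier_coeff f k"
proof -
  let ?e = "\<lambda>x. cis (- (of_int k * x))"
  have cf: "continuous_on UNIV f"
    using f by (intro continuous_on_vector_derivative) (auto intro: has_vector_derivative_at_within)
  have de: "(?e has_vector_derivative - (\<i> * of_int k) * ?e x) (at x within S)" for x S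
    using exp_scaleR_has_vector_derivative_right[of "- (\<i> * of_int k)" x S]
    by (simp add: cis_conv_exp scaleR_conv_of_real mult_ac)
  have int: "(\<lambda>x. f x * ?e x) integrable_on {-pi..pi}" "(\<lambda>x. f' x * ?e x) integrable_on {-pi..pi}"
    by (auto intro!: integrable_continuous_real continuous_intros continuous_on_subset[OF cf] continuous_on_subset[OF f'])
  have 1: "((\<lambda>x. f x * (- (\<i> * of_int k) * ?e x) + f' x * ?e x) has_integral f pi * ?e pi - f (-pi) * ?e (-pi)) {-pi..pi}"
    by (intro fundamental_theorem_of_calculus has_vector_derivative_mult de has_vector_derivative_at_within[OF f]) auto
  have 2: "?e (-pi) = ?e pi"
    by (simp add: complex_eq_iff mult.commute[of _ pi])
  have 3: "((\<lambda>x. f x * (- (\<i> * of_int k) * ?e x) + f' x * ?e x) has_integral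
      - (\<i> * of_int k) * integral {-pi..pi} (\<lambda>x. f x * ?e x) + integral {-pi..pi} (\<lambda>x. f' x * ?e x)) {-pi..pi}"
    using has_integral_add[OF has_integral_mult_right[OF integrable_integral[OF int(1)], of "- (\<i> * of_int k)"]
        integrable_integral[OF int(2)]]
    by (simp add: mult.left_commute[of "f _"])
  have "- (\<i> * of_int k) * integral {-pi..pi} (\<lambda>x. f x * ?e x) + integral {-pi..pi} (\<lambda>x. f' x * ?e x) = 0"
    using has_integral_unique[OF 1 3] unfolding 2 per by simp
  then have "integral {-pi..pi} (\<lambda>x. f' x * ?e x) = \<i> * of_int k * integral {-pi..pi} (\<lambda>x. f x * ?e x)"
    by (simp add: add_eq_0_iff)
  then show ?thesis
    by (simp add: fourier_coeff_continuous(2)[OF cf] fourier_coeff_continuous(2)[OF f'])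
qed

lemma smooth_periodic_deriv:
  assumes "\<phi> \<in> smooth_periodic"
  shows "(nth_deriv n \<phi> has_vector_derivative nth_deriv (Suc n) \<phi> x) (at x)"
    and "continuous_on UNIV (nth_deriv n \<phi>)" and "nth_deriv n \<phi> pi = nth_deriv n \<phi> (- pi)"
proof -
  have diff: "nth_deriv n \<phi> differentiable_on UNIV" for n
    using assms by (simp add: smooth_periodic_def)
  have Suc: "nth_deriv (Suc n) \<phi> x = vector_derivative (nth_deriv n \<phi>) (at x)" for n x
    by (simp add: nth_deriv_def)
  have d: "(nth_deriv n \<phi> has_vector_derivative nth_deriv (Suc n) \<phi> x) (at x)" for n x
    using diff[of n] unfolding Suc by (simp add: differentiable_on_def vector_derivative_works[symmetric])
  then show "(nth_deriv n \<phi> has_vector_derivative nth_deriv (Suc n) \<phi> x) (at x)" .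
  show "continuous_on UNIV (nth_deriv n \<phi>)"
    using diff by (rule differentiable_imp_continuous_on)
  have "nth_deriv n \<phi> (x + 2 * pi) = nth_deriv n \<phi> x" for x
  proof (induction n arbitrary: x)
    case 0
    then show ?case
      using assms by (simp add: smooth_periodic_def periodic_def nth_deriv_def)
  next
    case (Suc n)
    have "((\<lambda>y. nth_deriv n \<phi> (y + 2 * pi)) has_vector_derivative nth_deriv (Suc n) \<phi> (x + 2 * pi)) (at x)"
    proof -
      have "((\<lambda>y. y + 2 * pi) has_vector_derivative 1) (at x)"
        by (auto intro!: derivative_eq_intros)
      from vector_diff_chain_at[OF this d] show ?thesis
        by (simp add: o_def)
    qed
    then have "(nth_deriv n \<phi> has_vector_derivative nth_deriv (Suc n) \<phi> (x + 2 * pi)) (at x)"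
      by (simp add: Suc)
    then show ?case
      using vector_derivative_unique_at[OF d] by metis
  qed
  from this[of "- pi"] show "nth_deriv n \<phi> pi = nth_deriv n \<phi> (- pi)"
    by simp
qed

lemma smooth_periodic_integrable: "\<phi> \<in> smooth_periodic \<Longrightarrow> integrable torus \<phi>"
  using fourier_coeff_continuous(1) smooth_periodic_deriv(2)[of \<phi> 0] by (simp add: nth_deriv_def)

definition deriv_sup :: "nat \<Rightarrow> (real \<Rightarrow> complex) \<Rightarrow> real" where
  "deriv_sup n \<phi> = (SUP x\<in>{-pi..pi}. cmod (nth_deriv n \<phi> x))"

lemma deriv_sup_upper:
  assumes "\<phi> \<in> smooth_periodic" "x \<in> {-pi..pi}"
  shows "cmod (nth_deriv n \<phi> x) \<le> deriv_sup n \<phi>"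
  unfolding deriv_sup_def
proof (rule cSUP_upper[OF assms(2)])
  have "compact ((\<lambda>x. cmod (nth_deriv n \<phi> x)) ` {-pi..pi})"
    using continuous_on_subset[OF smooth_periodic_deriv(2)[OF assms(1)]]
    by (intro compact_continuous_image continuous_intros) auto
  then show "bdd_above ((\<lambda>x. cmod (nth_deriv n \<phi> x)) ` {-pi..pi})"
    by (intro bounded_imp_bdd_above compact_imp_bounded)
qed

lemma deriv_sup_nonneg: "\<phi> \<in> smooth_periodic \<Longrightarrow> 0 \<le> deriv_sup n \<phi>"
  using order_trans[OF norm_ge_zero deriv_sup_upper[of \<phi> 0 n]] by simp

lemma norm_fourier_coeff_le_sup:
  assumes "integrable torus f" "\<And>x. x \<in> {-pi..pi} \<Longrightarrow> cmod (f x) \<le> B"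
  shows "cmod (fourier_coeff f k) \<le> B"
proof -
  have "cmod (LINT x|torus. f x * cis (- (of_int k * x))) \<le> (LINT x|torus. cmod (f x * cis (- (of_int k * x))))"
    by (rule integral_norm_bound)
  also have "\<dots> \<le> (LINT x|torus. B)"
    using assms finite_measure.integrable_const[OF finite_measure_torus]
    by (intro integral_mono) (auto simp: norm_mult)
  also have "\<dots> = 2 * pi * B"
    by (simp add: measure_restrict_space)
  finally show ?thesis
    by (simp add: fourier_coeff_torus norm_divide field_simps)
qed

text \<open>Two integrations by parts give the decay \<open>k\<^sup>-\<^sup>2\<close>, which is summable, so that bounded sequences can
  be paired with the coefficients of a test function.\<close>

lemma smooth_fourier_decay:
  assumes \<phi>: "\<phi> \<in> smooth_periodic"
  shows "cmod (fourier_coeff \<phi> k) \<le> 4 * (deriv_sup 0 \<phi> + deriv_sup 2 \<phi>) * wgt (- 2) k"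
proof -
  note d = smooth_periodic_deriv[OF \<phi>]
  have [simp]: "nth_deriv 0 \<phi> = \<phi>"
    by (simp add: nth_deriv_def)
  have fc: "cmod (fourier_coeff (nth_deriv n \<phi>) k) \<le> deriv_sup n \<phi>" for n
    using deriv_sup_upper[OF \<phi>] by (intro norm_fourier_coeff_le_sup fourier_coeff_continuous(1) d(2))
  have step: "fourier_coeff (nth_deriv (Suc n) \<phi>) k = \<i> * of_int k * fourier_coeff (nth_deriv n \<phi>) k" for n
    using d by (intro fourier_coeff_derivative) auto
  have "fourier_coeff (nth_deriv 2 \<phi>) k = (\<i> * of_int k) * ((\<i> * of_int k) * fourier_coeff \<phi> k)"
    using step[of 0] step[of 1] by (simp add: numeral_2_eq_2)
  then have "\<bar>real_of_int k\<bar> * (\<bar>real_of_int k\<bar> * cmod (fourier_coeff \<phi> k)) \<le> deriv_sup 2 \<phi>"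
    using fc[of 2] by (simp add: norm_mult)
  then have k2: "\<bar>real_of_int k\<bar>\<^sup>2 * cmod (fourier_coeff \<phi> k) \<le> deriv_sup 2 \<phi>"
    by (simp only: power2_eq_square mult.assoc)
  have "(1 + \<bar>real_of_int k\<bar>)\<^sup>2 \<le> 4 * (1 + \<bar>real_of_int k\<bar>\<^sup>2)"
    using sum_squares_bound[of 1 "\<bar>real_of_int k\<bar>"] by (simp add: power2_sum)
  then have "(1 + \<bar>real_of_int k\<bar>)\<^sup>2 * cmod (fourier_coeff \<phi> k) \<le> 4 * (1 + \<bar>real_of_int k\<bar>\<^sup>2) * cmod (fourier_coeff \<phi> k)"
    by (intro mult_right_mono) auto
  also have "\<dots> = 4 * (cmod (fourier_coeff \<phi> k) + \<bar>real_of_int k\<bar>\<^sup>2 * cmod (fourier_coeff \<phi> k))"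
    by (simp only: distrib_right distrib_left mult_1 mult.assoc)
  also have "\<dots> \<le> 4 * (deriv_sup 0 \<phi> + deriv_sup 2 \<phi>)"
    using fc[of 0] k2 by simp
  finally have "(1 + \<bar>real_of_int k\<bar>)\<^sup>2 * cmod (fourier_coeff \<phi> k) \<le> 4 * (deriv_sup 0 \<phi> + deriv_sup 2 \<phi>)" .
  then have "wgt (- 2) k * ((1 + \<bar>real_of_int k\<bar>)\<^sup>2 * cmod (fourier_coeff \<phi> k))
      \<le> wgt (- 2) k * (4 * (deriv_sup 0 \<phi> + deriv_sup 2 \<phi>))"
    by (intro mult_left_mono) auto
  moreover have w: "wgt (- 2) k * (1 + \<bar>real_of_int k\<bar>)\<^sup>2 = 1"
    using wgt_mult[of "- 2" k 2] by (simp add: wgt_def powr_numeral)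
  have "wgt (- 2) k * ((1 + \<bar>real_of_int k\<bar>)\<^sup>2 * cmod (fourier_coeff \<phi> k)) = cmod (fourier_coeff \<phi> k)"
    unfolding mult.assoc[symmetric] w by simp
  ultimately show ?thesis
    by (metis mult.commute)
qed

text \<open>The distribution \<open>\<Sum> c k e\<^sup>i\<^sup>k\<^sup>x\<close>: the integral of \<open>e\<^sup>i\<^sup>k\<^sup>x \<phi>\<close> is \<open>2 \<pi>\<close> times the coefficient of
  \<open>\<phi>\<close> at \<open>- k\<close>.\<close>

definition fourier_distribution :: "(int \<Rightarrow> real) \<Rightarrow> (real \<Rightarrow> complex) \<Rightarrow> complex" where
  "fourier_distribution c \<phi> = of_real (2 * pi) * (\<Sum>\<^sub>\<infinity>k. of_real (c k) * fourier_coeff \<phi> (- k))"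

lemma fourier_distribution_bound:
  assumes c: "\<And>k. \<bar>c k\<bar> \<le> X" and \<phi>: "\<phi> \<in> smooth_periodic"
  shows "(\<lambda>k. cmod (of_real (c k) * fourier_coeff \<phi> (- k))) summable_on UNIV"
    and "cmod (fourier_distribution c \<phi>)
      \<le> 8 * pi * X * (\<Sum>\<^sub>\<infinity>k. wgt (- 2) k) * (deriv_sup 0 \<phi> + deriv_sup 2 \<phi>)"
proof -
  define D where "D = deriv_sup 0 \<phi> + deriv_sup 2 \<phi>"
  have X: "0 \<le> X"
    using order_trans[OF abs_ge_zero c] .
  have le: "cmod (of_real (c k) * fourier_coeff \<phi> (- k)) \<le> X * (4 * D) * wgt (- 2) k" for k
  proof -
    have "cmod (of_real (c k) * fourier_coeff \<phi> (- k)) \<le> X * (4 * D * wgt (- 2) (- k))"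
      unfolding norm_mult D_def using c X by (intro mult_mono smooth_fourier_decay \<phi>) auto
    then show ?thesis
      by (simp add: mult.assoc)
  qed
  have w: "wgt (- 2) summable_on UNIV"
    by (rule wgt_summable) simp
  have sum: "(\<lambda>k. X * (4 * D) * wgt (- 2) k) summable_on UNIV"
    using w by (rule summable_on_cmult_right)
  show s: "(\<lambda>k. cmod (of_real (c k) * fourier_coeff \<phi> (- k))) summable_on UNIV"
    using sum le by (rule Infinite_Sum.abs_summable_on_comparison_test')
  have "cmod (\<Sum>\<^sub>\<infinity>k. of_real (c k) * fourier_coeff \<phi> (- k)) \<le> (\<Sum>\<^sub>\<infinity>k. cmod (of_real (c k) * fourier_coeff \<phi> (- k)))"
    using s by (rule norm_infsum_bound)
  also have "\<dots> \<le> (\<Sum>\<^sub>\<infinity>k. X * (4 * D) * wgt (- 2) k)"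
    using s sum le by (rule infsum_mono)
  also have "\<dots> = X * (4 * D) * (\<Sum>\<^sub>\<infinity>k. wgt (- 2) k)"
    by (rule infsum_cmult_right')
  finally have "2 * pi * cmod (\<Sum>\<^sub>\<infinity>k. of_real (c k) * fourier_coeff \<phi> (- k))
      \<le> 2 * pi * (X * (4 * D) * (\<Sum>\<^sub>\<infinity>k. wgt (- 2) k))"
    by (intro mult_left_mono) auto
  then show "cmod (fourier_distribution c \<phi>) \<le> 8 * pi * X * (\<Sum>\<^sub>\<infinity>k. wgt (- 2) k) * (deriv_sup 0 \<phi> + deriv_sup 2 \<phi>)"
    by (simp add: fourier_distribution_def norm_mult D_def[symmetric] mult_ac)
qed

lemma fourier_distribution_summable:
  assumes "\<And>k. \<bar>c k\<bar> \<le> X" "\<phi> \<in> smooth_periodic"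
  shows "(\<lambda>k. of_real (c k) * fourier_coeff \<phi> (- k)) summable_on UNIV"
  by (rule Infinite_Sum.abs_summable_summable, rule fourier_distribution_bound(1)[OF assms])

lemma periodic_distribution_fourier:
  assumes c: "\<And>k. \<bar>c k\<bar> \<le> X"
  shows "periodic_distribution (fourier_distribution c)"
  unfolding periodic_distribution_def
proof (intro conjI ballI allI)
  fix \<phi> \<psi> assume \<phi>: "\<phi> \<in> smooth_periodic" and \<psi>: "\<psi> \<in> smooth_periodic"
  have "(\<Sum>\<^sub>\<infinity>k. of_real (c k) * fourier_coeff (\<lambda>x. \<phi> x + \<psi> x) (- k))
      = (\<Sum>\<^sub>\<infinity>k. of_real (c k) * fourier_coeff \<phi> (- k) + of_real (c k) * fourier_coeff \<psi> (- k))"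
    using \<phi> \<psi> by (simp add: fourier_coeff_add smooth_periodic_integrable distrib_left)
  also have "\<dots> = (\<Sum>\<^sub>\<infinity>k. of_real (c k) * fourier_coeff \<phi> (- k)) + (\<Sum>\<^sub>\<infinity>k. of_real (c k) * fourier_coeff \<psi> (- k))"
    using c by (intro infsum_add fourier_distribution_summable \<phi> \<psi>)
  finally show "fourier_distribution c (\<lambda>x. \<phi> x + \<psi> x) = fourier_distribution c \<phi> + fourier_distribution c \<psi>"
    by (simp add: fourier_distribution_def distrib_left)
next
  fix b \<phi>
  have "(\<Sum>\<^sub>\<infinity>k. of_real (c k) * fourier_coeff (\<lambda>x. b * \<phi> x) (- k))
      = (\<Sum>\<^sub>\<infinity>k. b * (of_real (c k) * fourier_coeff \<phi> (- k)))"
    by (simp add: fourier_coeff_cmult mult.left_commute)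
  also have "\<dots> = b * (\<Sum>\<^sub>\<infinity>k. of_real (c k) * fourier_coeff \<phi> (- k))"
    by (rule infsum_cmult_right')
  finally show "fourier_distribution c (\<lambda>x. b * \<phi> x) = b * fourier_distribution c \<phi>"
    by (simp add: fourier_distribution_def)
next
  define C where "C = 8 * pi * X * (\<Sum>\<^sub>\<infinity>k. wgt (- 2) k)"
  have C: "0 \<le> C"
    using order_trans[OF abs_ge_zero c] by (simp add: C_def infsum_nonneg)
  have "cmod (fourier_distribution c \<phi>) \<le> C * (\<Sum>j\<le>2. SUP x\<in>{-pi..pi}. cmod (nth_deriv j \<phi> x))"
    if \<phi>: "\<phi> \<in> smooth_periodic" for \<phi>
  proof -
    have "cmod (fourier_distribution c \<phi>) \<le> C * (deriv_sup 0 \<phi> + deriv_sup 2 \<phi>)"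
      unfolding C_def using c \<phi> by (rule fourier_distribution_bound)
    also have "\<dots> \<le> C * (\<Sum>j\<le>2. deriv_sup j \<phi>)"
      using C deriv_sup_nonneg[OF \<phi>, of 1] by (intro mult_left_mono) (auto simp: numeral_2_eq_2)
    finally show ?thesis
      by (simp add: deriv_sup_def)
  qed
  then show "\<exists>C N. \<forall>\<phi>\<in>smooth_periodic. cmod (fourier_distribution c \<phi>)
      \<le> C * (\<Sum>j\<le>N. SUP x\<in>{-pi..pi}. cmod (nth_deriv j \<phi> x))"
    by blast
qed

lemma dist_coeff_fourier_distribution: "dist_coeff (fourier_distribution c) k = of_real (c k)"
proof -
  have "fourier_coeff (\<lambda>x. cis (- (of_int k * x))) j = (if j = - k then 1 else 0)" for j
    using fourier_coeff_mult_cis[of "\<lambda>_. 1" "- k" j] by (auto simp: fourier_coeff_const)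
  then have "(\<Sum>\<^sub>\<infinity>j. of_real (c j) * fourier_coeff (\<lambda>x. cis (- (of_int k * x))) (- j)) = (\<Sum>\<^sub>\<infinity>j\<in>{k}. complex_of_real (c j))"
    by (intro infsum_cong_neutral) auto
  then show ?thesis
    by (simp add: dist_coeff_def fourier_distribution_def)
qed

text \<open>Conjugation replaces \<open>k\<close> by \<open>- k\<close> in the coefficients of a real test function, and the real
  even sequence \<open>c\<close> is invariant under this.\<close>

lemma real_valued_fourier_distribution:
  assumes even: "\<And>k. c (- k) = c k"
  shows "real_valued_dist (fourier_distribution c)"
  unfolding real_valued_dist_def
proof safe
  fix \<phi> :: "real \<Rightarrow> complex" assume "\<forall>x. \<phi> x \<in> \<real>"
  then have "(\<lambda>x. cnj (\<phi> x)) = \<phi>"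
    by (auto simp: Reals_cnj_iff)
  then have fc: "cnj (fourier_coeff \<phi> (- k)) = fourier_coeff \<phi> k" for k
    using fourier_coeff_cnj[of \<phi> k] by simp
  have "cnj (\<Sum>\<^sub>\<infinity>k. of_real (c k) * fourier_coeff \<phi> (- k)) = (\<Sum>\<^sub>\<infinity>k. cnj (of_real (c k) * fourier_coeff \<phi> (- k)))"
    by (rule infsum_cnj[symmetric])
  also have "\<dots> = (\<Sum>\<^sub>\<infinity>k. of_real (c k) * fourier_coeff \<phi> k)"
    by (simp add: fc)
  also have "\<dots> = (\<Sum>\<^sub>\<infinity>k. of_real (c (- k)) * fourier_coeff \<phi> (- k))"
    by (rule infsum_reindex_bij_betw[symmetric]) (simp add: bij_uminus)
  also have "\<dots> = (\<Sum>\<^sub>\<infinity>k. of_real (c k) * fourier_coeff \<phi> (- k))"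
    by (simp add: even)
  finally show "fourier_distribution c \<phi> \<in> \<real>"
    by (simp add: fourier_distribution_def Reals_cnj_iff)
qed

section \<open>Bertrand series and the critical potential\<close>

text \<open>Cauchy condensation.\<close>

lemma summable_bertrand:
  fixes r :: real
  assumes "0 \<le> r"
  shows "summable (\<lambda>n. 1 / real n * ln (1 + real n) powr (- r)) \<longleftrightarrow>
    summable (\<lambda>n. ln (1 + 2 ^ n) powr (- r) :: real)"
proof -
  let ?f = "\<lambda>n. 1 / real n * ln (1 + real n) powr (- r)"
  have "summable ?f \<longleftrightarrow> summable (\<lambda>n. 2 ^ n * ?f (2 ^ n))"
  proof (rule condensation_test)
    show "?f (Suc m) \<le> ?f m" if "0 < m" for m
      using that assms by (intro mult_mono powr_mono2' divide_left_mono) auto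
  qed auto
  then show ?thesis
    by simp
qed

lemma ln_dyadic_bounds:
  shows "real n * ln 2 \<le> ln (1 + 2 ^ n)" "ln (1 + 2 ^ n) \<le> real (Suc n) * ln 2"
proof -
  have "real n * ln 2 = ln (2 ^ n)" "real (Suc n) * ln 2 = ln (2 ^ Suc n)"
    by (simp_all only: ln_realpow zero_less_numeral)
  then show "real n * ln 2 \<le> ln (1 + 2 ^ n)" "ln (1 + 2 ^ n) \<le> real (Suc n) * ln 2"
    by (simp_all add: add_pos_pos)
qed

lemma summable_bertrand_gt_1:
  assumes "1 < r"
  shows "summable (\<lambda>n. 1 / real n * ln (1 + real n) powr (- r))"
proof -
  have "summable (\<lambda>n. real n powr (- r) * ln 2 powr (- r))"
    using assms by (intro summable_mult2) (simp add: summable_real_powr_iff)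
  then have "summable (\<lambda>n. ln (1 + 2 ^ n) powr (- r) :: real)"
  proof (rule summable_comparison_test_ev[rotated])
    show "\<forall>\<^sub>F n in sequentially. norm (ln (1 + 2 ^ n) powr (- r) :: real) \<le> real n powr (- r) * ln 2 powr (- r)"
      using eventually_gt_at_top[of 0]
    proof eventually_elim
      case (elim n)
      have "ln (1 + 2 ^ n) powr (- r) \<le> (real n * ln 2) powr (- r)"
        using elim assms ln_dyadic_bounds(1)[of n] by (intro powr_mono2') auto
      then show ?case
        by (simp add: powr_mult)
    qed
  qed
  with assms show ?thesis
    by (subst summable_bertrand) auto
qed

lemma not_summable_bertrand_1: "\<not> summable (\<lambda>n. 1 / real n * ln (1 + real n) powr (- 1))"
proof
  assume "summable (\<lambda>n. 1 / real n * ln (1 + real n) powr (- 1))"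
  then have "summable (\<lambda>n. ln (1 + 2 ^ n) powr (- 1) :: real)"
    by (subst (asm) summable_bertrand) auto
  then have "summable (\<lambda>n. ln 2 * (ln (1 + 2 ^ n) powr (- 1)) :: real)"
    by (rule summable_mult)
  then have "summable (\<lambda>n. inverse (real (Suc n)))"
  proof (rule summable_comparison_test'[where N = 0])
    fix n :: nat
    have pos: "0 < ln (1 + 2 ^ n :: real)"
      by (rule ln_gt_zero) simp
    have "inverse (real (Suc n)) = ln 2 / (real (Suc n) * ln 2)"
      by (simp add: inverse_eq_divide del: of_nat_Suc)
    also have "\<dots> \<le> ln 2 / ln (1 + 2 ^ n)"
      using ln_dyadic_bounds(2)[of n] pos by (intro divide_left_mono) auto
    finally show "norm (inverse (real (Suc n))) \<le> ln 2 * (ln (1 + 2 ^ n) powr (- 1))"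
      using pos by (simp add: powr_minus_divide)
  qed
  then have "summable (\<lambda>n. inverse (real n))"
    by (subst (asm) summable_Suc_iff)
  then show False
    using not_summable_harmonic by auto
qed

text \<open>At \<open>k = 0\<close> the value is \<open>0\<close>, by the convention \<open>0 powr x = 0\<close>.\<close>

definition log_power_coeff :: "real \<Rightarrow> int \<Rightarrow> real" where
  "log_power_coeff \<alpha> k = \<bar>of_int k\<bar> powr (- \<alpha>) * ln (1 + \<bar>of_int k\<bar>) powr (- 1 / 2)"

lemma log_power_coeff_even [simp]: "log_power_coeff \<alpha> (- k) = log_power_coeff \<alpha> k"
  by (simp add: log_power_coeff_def)

lemma log_power_coeff_nonneg [simp]: "0 \<le> log_power_coeff \<alpha> k"
  by (simp add: log_power_coeff_def)

lemma log_power_coeff_bounded: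
  assumes "0 \<le> \<alpha>"
  shows "\<bar>log_power_coeff \<alpha> k\<bar> \<le> ln 2 powr (- 1 / 2)"
proof (cases "k = 0")
  case True
  then show ?thesis by (simp add: log_power_coeff_def)
next
  case False
  then have k: "1 \<le> \<bar>real_of_int k\<bar>"
    by linarith
  have "\<bar>real_of_int k\<bar> powr (- \<alpha>) * ln (1 + \<bar>real_of_int k\<bar>) powr (- 1 / 2) \<le> 1 * ln 2 powr (- 1 / 2)"
  proof (intro mult_mono)
    show "\<bar>real_of_int k\<bar> powr (- \<alpha>) \<le> 1"
      using powr_mono[of "- \<alpha>" 0 "\<bar>real_of_int k\<bar>"] k assms False by simp
    show "ln (1 + \<bar>real_of_int k\<bar>) powr (- 1 / 2) \<le> ln 2 powr (- 1 / 2)"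
      using k by (intro powr_mono2') auto
  qed auto
  then show ?thesis
    by (simp add: log_power_coeff_def abs_mult)
qed

lemma power_mult_log_power_coeff: "\<bar>of_int k\<bar> powr s * log_power_coeff (s + q) k = log_power_coeff q k"
  by (simp add: log_power_coeff_def powr_add[symmetric] flip: mult.assoc)

text \<open>For finite \<open>p\<close> the \<open>p\<close>-th powers are the terms \<open>1/(k (ln (1 + k))\<^sup>p\<^sup>/\<^sup>2)\<close> of a Bertrand series with
  exponent \<open>p/2 > 1\<close>.  For \<open>p = \<infinity>\<close> the logarithm alone gives a bounded sequence.\<close>

lemma in_lp_log_power_coeff:
  assumes "2 < p"
  shows "in_lp p (\<lambda>k. of_real (log_power_coeff (real_of_ereal (1 / p)) k))"
proof (cases p)
  case PInf
  then show ?thesis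
    using log_power_coeff_bounded[of 0] by (auto simp: in_lp_def bounded_iff)
next
  case MInf
  then show ?thesis using assms by simp
next
  case (real P)
  then have P: "2 < P"
    using assms by simp
  have "real_of_ereal (1 / p) = 1 / P"
    using real P by (simp add: one_ereal_def)
  moreover have "(\<lambda>k. log_power_coeff (1 / P) k powr P) summable_on UNIV"
  proof (rule summable_on_int_even)
    have "summable (\<lambda>n. 1 / real n * ln (1 + real n) powr (- (P / 2)))"
      using P by (intro summable_bertrand_gt_1) auto
    moreover have "log_power_coeff (1 / P) (int n) powr P = 1 / real n * ln (1 + real n) powr (- (P / 2))" for n
    proof -
      have "log_power_coeff (1 / P) (int n) powr P
          = (real n powr (- (1 / P))) powr P * (ln (1 + real n) powr (- 1 / 2)) powr P"
        by (simp add: log_power_coeff_def powr_mult)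
      also have "\<dots> = real n powr (- 1) * ln (1 + real n) powr (- (P / 2))"
        unfolding powr_powr using P by simp
      finally show ?thesis
        by (simp add: powr_minus_divide)
    qed
    ultimately show "summable (\<lambda>n. log_power_coeff (1 / P) (int n) powr P)"
      by simp
  qed auto
  ultimately show ?thesis
    using real by (simp add: in_lp_def)
qed

text \<open>At the critical exponent \<open>m = \<alpha> - 1/2\<close> the squared terms are comparable to \<open>1/(k ln k)\<close>, and larger
  exponents only increase them.\<close>

lemma log_power_coeff_not_weighted_l2:
  assumes m: "\<alpha> - 1 / 2 \<le> m" and \<alpha>: "0 \<le> \<alpha>"
  shows "\<not> weighted_l2 m (\<lambda>k. of_real (log_power_coeff \<alpha> k)) B"
proof
  assume B: "weighted_l2 m (\<lambda>k. of_real (log_power_coeff \<alpha> k)) B"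
  have le: "1 / real n * ln (1 + real n) powr (- 1) \<le> 2 * (wgt m (int n) * log_power_coeff \<alpha> (int n))\<^sup>2" for n
  proof (cases "n = 0")
    case False
    then have n: "1 \<le> real n" by simp
    have sq: "(y powr e)\<^sup>2 = y powr (2 * e)" for y e :: real
      by (simp add: power2_eq_square flip: powr_add)
    have "1 / (2 * real n) \<le> 1 / (1 + real n)"
      using n by (intro divide_left_mono) auto
    also have "1 / (1 + real n) = real n powr (2 * \<alpha>) * real n powr (- (2 * \<alpha>)) / (1 + real n)"
      using n by (simp flip: powr_add)
    also have "\<dots> \<le> (1 + real n) powr (2 * \<alpha>) * real n powr (- (2 * \<alpha>)) / (1 + real n)"
      using n \<alpha> by (intro divide_right_mono mult_right_mono powr_mono2) auto
    also have "\<dots> = (1 + real n) powr (2 * \<alpha> - 1) * real n powr (- (2 * \<alpha>))"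
      using n by (simp add: powr_diff)
    also have "\<dots> \<le> (1 + real n) powr (2 * m) * real n powr (- (2 * \<alpha>))"
      using m n by (intro mult_right_mono powr_mono) auto
    finally have "1 / (2 * real n) * ln (1 + real n) powr (- 1)
        \<le> (1 + real n) powr (2 * m) * real n powr (- (2 * \<alpha>)) * ln (1 + real n) powr (- 1)"
      by (rule mult_right_mono) auto
    also have "\<dots> = (wgt m (int n) * log_power_coeff \<alpha> (int n))\<^sup>2"
      by (simp add: wgt_def log_power_coeff_def power_mult_distrib sq)
    finally have "1 / (2 * real n) * ln (1 + real n) powr (- 1) \<le> (wgt m (int n) * log_power_coeff \<alpha> (int n))\<^sup>2" .
    moreover have "1 / real n * ln (1 + real n) powr (- 1) = 2 * (1 / (2 * real n) * ln (1 + real n) powr (- 1))"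
      by simp
    ultimately show ?thesis by linarith
  qed simp
  have "summable (\<lambda>n. (wgt m (int n) * log_power_coeff \<alpha> (int n))\<^sup>2)"
  proof (rule bounded_imp_summable)
    show "(\<Sum>n\<le>N. (wgt m (int n) * log_power_coeff \<alpha> (int n))\<^sup>2) \<le> B\<^sup>2" for N
    proof -
      have "L2_set (\<lambda>k. wgt m k * cmod (of_real (log_power_coeff \<alpha> k))) (int ` {..N}) \<le> B"
        using B by (rule weighted_l2D) simp
      then have "sqrt (\<Sum>n\<le>N. (wgt m (int n) * log_power_coeff \<alpha> (int n))\<^sup>2) \<le> B"
        by (simp add: L2_set_def sum.reindex power_mult_distrib)
      then show ?thesis
        using sqrt_le_D by blast
    qed
  qed simp
  then have "summable (\<lambda>n. 2 * (wgt m (int n) * log_power_coeff \<alpha> (int n))\<^sup>2)"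
    by (rule summable_mult)
  then have "summable (\<lambda>n. 1 / real n * ln (1 + real n) powr (- 1))"
  proof (rule summable_comparison_test'[where N = 0])
    fix n :: nat
    have "0 \<le> 1 / real n * ln (1 + real n) powr (- 1)"
      by simp
    then show "norm (1 / real n * ln (1 + real n) powr (- 1)) \<le> 2 * (wgt m (int n) * log_power_coeff \<alpha> (int n))\<^sup>2"
      using le[of n] unfolding real_norm_def by (subst abs_of_nonneg)
  qed
  then show False
    using not_summable_bertrand_1 by blast
qed

section \<open>Ill-posedness\<close>

lemma sobolev_term_const: "sobolev_term \<sigma> (\<lambda>_. c) = (\<lambda>k. if k = 0 then (cmod c)\<^sup>2 else 0)"
  by (auto simp: fourier_coeff_const)

lemma const_sobolev: "(\<lambda>_. c) \<in> sobolev \<sigma>"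
proof -
  have "(\<lambda>k::int. if k = 0 then (cmod c)\<^sup>2 else 0) summable_on UNIV"
    by (rule finite_nonzero_values_imp_summable_on) (auto intro: finite_subset[of _ "{0}"])
  moreover have "set_integrable lebesgue {-pi..pi} (\<lambda>_. (cmod c)\<^sup>2)"
    unfolding integrable_torus_iff[symmetric] by (rule finite_measure.integrable_const[OF finite_measure_torus])
  ultimately show ?thesis
    by (simp add: sobolev_def L2_periodic_def periodic_def sobolev_term_const)
qed

lemma sobolev_norm_const: "sobolev_norm \<sigma> (\<lambda>_. c) = cmod c"
proof -
  have "(\<Sum>\<^sub>\<infinity>k::int. if k = 0 then (cmod c)\<^sup>2 else 0) = (\<Sum>\<^sub>\<infinity>k\<in>{0::int}. (cmod c)\<^sup>2)"
    by (intro infsum_cong_neutral) auto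
  then show ?thesis
    by (simp add: sobolev_norm_def sobolev_term_const)
qed

lemma zero_solution: "duhamel_solution \<xi> lam \<sigma> (\<lambda>_. 0) (\<lambda>_ _. 0)"
proof -
  have "forcing_coeff \<xi> lam (\<lambda>_. 0) k = 0" for k
    by (simp add: forcing_coeff_def mult_coeff_def fourier_coeff_const)
  then show ?thesis
    using const_sobolev[of 0] sobolev_norm_const[of \<sigma> 0]
    by (simp add: duhamel_solution_def continuous_curve_def schrodinger_group_def fourier_coeff_const)
qed

lemma zero_smooth_ball:
  assumes "0 \<le> \<epsilon>"
  shows "(\<lambda>_. 0) \<in> smooth_ball \<sigma> \<epsilon>"
proof -
  have "nth_deriv n (\<lambda>_. 0) = (\<lambda>_. 0)" for n
    by (induction n) (auto simp: nth_deriv_def vector_derivative_const_at)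
  with assms show ?thesis
    using sobolev_norm_const[of \<sigma> 0] by (simp add: smooth_ball_def smooth_periodic_def periodic_def)
qed

text \<open>The zero datum has the zero solution, but arbitrarily small constants have no solution; so the
  continuity condition fails for every candidate solution \<open>u\<close>, independently of uniqueness.\<close>

lemma ill_posed_if_singular_potential:
  assumes "\<And>k. cmod (dist_coeff \<xi> k) \<le> X" "\<And>B. \<not> weighted_l2 (\<sigma> - 2) (dist_coeff \<xi>) B" "3 / 2 \<le> \<sigma>"
  shows "ill_posed \<xi> lam \<sigma>"
  unfolding ill_posed_def
proof safe
  fix \<epsilon> :: real assume "0 < \<epsilon>"
  have "solution_map_discontinuous_at \<xi> lam \<sigma> (\<lambda>_. 0)"
    unfolding solution_map_discontinuous_at_def
  proof (intro conjI allI impI notI)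
    show "\<exists>u. duhamel_solution \<xi> lam \<sigma> (\<lambda>_. 0) u"
      using zero_solution by blast
    fix u
    assume "\<forall>e>0. \<exists>d>0. \<forall>v\<in>sobolev \<sigma>. sobolev_norm \<sigma> (\<lambda>x. v x - 0) < d \<longrightarrow>
      (\<exists>w. duhamel_solution \<xi> lam \<sigma> v w \<and> (\<forall>t\<in>{0..1}. sobolev_norm \<sigma> (\<lambda>x. w t x - u t x) < e))"
    then obtain d where d: "0 < d" "\<And>v. v \<in> sobolev \<sigma> \<Longrightarrow> sobolev_norm \<sigma> v < d \<Longrightarrow> \<exists>w. duhamel_solution \<xi> lam \<sigma> v w"
      using zero_less_one by (metis (no_types, lifting) diff_zero ext)
    have "sobolev_norm \<sigma> (\<lambda>_. complex_of_real (d / 2)) < d"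
      using d(1) by (simp only: sobolev_norm_const norm_of_real)
    with d(2)[OF const_sobolev] obtain w where "duhamel_solution \<xi> lam \<sigma> (\<lambda>_. of_real (d / 2)) w"
      by blast
    with no_duhamel_solution_constant_data[OF assms, of "d / 2"] d(1) show False
      by simp
  qed
  then show "\<exists>u0\<in>smooth_ball \<sigma> \<epsilon>. solution_map_discontinuous_at \<xi> lam \<sigma> u0"
    using zero_smooth_ball \<open>0 < \<epsilon>\<close> by (intro bexI[of _ "\<lambda>_. 0"]) auto
qed

theorem theorem1p3:
  fixes lam s \<gamma> :: real and p :: ereal
  assumes "0 \<le> s" and "2 < p" and "3 / 2 + real_of_ereal (1 / p) \<le> \<gamma>"
  shows "\<exists>\<xi>\<in>b_hat s p. real_valued_dist \<xi> \<and> ill_posed \<xi> lam (s + \<gamma>)"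
proof -
  define q where "q = real_of_ereal (1 / p)"
  define c where "c = log_power_coeff (s + q)"
  define \<xi> where "\<xi> = fourier_distribution c"
  have q: "0 \<le> q"
    using assms(2) by (cases p) (auto simp: q_def one_ereal_def)
  have bound: "\<bar>c k\<bar> \<le> ln 2 powr (- 1 / 2)" for k
    unfolding c_def using assms(1) q by (intro log_power_coeff_bounded) auto
  have coeff: "dist_coeff \<xi> = (\<lambda>k. of_real (c k))"
    by (auto simp: \<xi>_def dist_coeff_fourier_distribution)
  have "\<xi> \<in> b_hat s p"
  proof -
    have "periodic_distribution \<xi>"
      unfolding \<xi>_def using bound by (rule periodic_distribution_fourier)
    moreover have "in_lp p (\<lambda>k. of_real (\<bar>of_int k\<bar> powr s) * dist_coeff \<xi> k)"
      using in_lp_log_power_coeff[OF assms(2)]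
      by (simp add: coeff c_def power_mult_log_power_coeff q_def[symmetric] flip: of_real_mult)
    ultimately show ?thesis
      by (simp add: b_hat_def)
  qed
  moreover have "real_valued_dist \<xi>"
    unfolding \<xi>_def by (rule real_valued_fourier_distribution) (simp add: c_def)
  moreover have "ill_posed \<xi> lam (s + \<gamma>)"
  proof (rule ill_posed_if_singular_potential)
    show "cmod (dist_coeff \<xi> k) \<le> ln 2 powr (- 1 / 2)" for k
      using bound by (simp add: coeff)
    show "\<not> weighted_l2 (s + \<gamma> - 2) (dist_coeff \<xi>) B" for B
      unfolding coeff c_def using assms q
      by (intro log_power_coeff_not_weighted_l2) (auto simp: q_def)
    show "3 / 2 \<le> s + \<gamma>"
      using assms q by (simp add: q_def)
  qed
  ultimately show ?thesis by blast
qed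

end
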